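(* There exists $\overline{\rho}_c\in(0,\infty)$ such that for any $\rho>\overline{\rho}_c$ the Lyapunov exponent $\lambda(\rho,\beta)$ is analytic (at all $(\rho,\beta)$ with $\rho>\overline{\rho}_c$, $\beta>0$), and hence there are no phase transitions there.
   Context: For $\rho>0,\beta>0$ the Lyapunov exponent is $\lambda(\rho,\beta)=\lim_{n\to\infty}\frac1n\log\mathbb{E}[x_n]$, where $x_{i+1}=a_ix_i$, $x_0>0$ deterministic, $a_i=1+\rho e^{\sigma W(t_i)-\frac12\sigma^2t_i}$, $t_i=i\tau$, $W$ is a standard Brownian motion, and the limit is taken with $\frac12\sigma^2\tau n^2=\beta$ fixed. The limit exists and equals $$\lambda(\rho,\beta)=\sup_{g}\left\{g(1)\log\rho+\beta\int_0^1(g(1)-g(x))^2dx-\int_0^1 I(g'(x))dx\right\},$$ the supremum being over absolutely continuous $g:[0,1]\to[0,1]$ with $g(0)=0$, $0\le g'\le1$ almost everywhere, and $I(x)=x\log x+(1-x)\log(1-x)$ ($0\log0=0$). Definition of phases: a phase is a connected region of the parameter space $\{(\rho,\beta)\}=(0,\infty)^2$, maximal for the condition that $\lambda(\rho,\beta)$ is analytic. There is a $j$th-order phase transition at a boundary point of a phase if at least one $j$th-order partial derivative of $\lambda(\rho,\beta)$ is discontinuous there, while all lower order derivatives are continuous. *)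

theory Defs
  imports "HOL-Probability.Probability"
begin

definition standard_brownian_motion :: "'a measure \<Rightarrow> (real \<Rightarrow> 'a \<Rightarrow> real) \<Rightarrow> bool" where
  "standard_brownian_motion M W \<longleftrightarrow>
     prob_space M \<and>
     (\<forall>t\<ge>0. W t \<in> borel_measurable M) \<and>
     (AE \<omega> in M. W 0 \<omega> = 0) \<and>
     (\<forall>s t. 0 \<le> s \<and> s < t \<longrightarrow>
        distributed M lborel (\<lambda>\<omega>. W t \<omega> - W s \<omega>) (normal_density 0 (sqrt (t - s)))) \<and>
     (\<forall>(t :: nat \<Rightarrow> real) k. 0 \<le> t 0 \<and> strict_mono_on {..k} t \<longrightarrow>
        prob_space.indep_vars M (\<lambda>_. borel) (\<lambda>i \<omega>. W (t (Suc i)) \<omega> - W (t i) \<omega>) {..<k}) \<and>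
     (AE \<omega> in M. continuous_on {0..} (\<lambda>t. W t \<omega>))"

definition multiplier ::
  "(real \<Rightarrow> 'a \<Rightarrow> real) \<Rightarrow> real \<Rightarrow> real \<Rightarrow> real \<Rightarrow> nat \<Rightarrow> 'a \<Rightarrow> real" where
  "multiplier W \<rho> \<sigma> \<tau> i \<omega> =
     1 + \<rho> * exp (\<sigma> * W (real i * \<tau>) \<omega> - \<sigma>\<^sup>2 * (real i * \<tau>) / 2)"

primrec growth_process ::
  "(real \<Rightarrow> 'a \<Rightarrow> real) \<Rightarrow> real \<Rightarrow> real \<Rightarrow> real \<Rightarrow> real \<Rightarrow> nat \<Rightarrow> 'a \<Rightarrow> real" where
  "growth_process W \<rho> \<sigma> \<tau> x0 0 = (\<lambda>\<omega>. x0)"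
| "growth_process W \<rho> \<sigma> \<tau> x0 (Suc i) =
     (\<lambda>\<omega>. multiplier W \<rho> \<sigma> \<tau> i \<omega> * growth_process W \<rho> \<sigma> \<tau> x0 i \<omega>)"

text \<open>
  The limit is taken along a scaling of the volatility and the time step: \<open>\<sigma> \<beta> n\<close> and \<open>\<tau> \<beta> n\<close> are
  the parameters used for the \<open>n\<close>-step process. No particular scaling is singled out (fixed time
  step, fixed volatility, fixed horizon \<open>n * \<tau> \<beta> n\<close>, ...); only the constraint has to hold.
\<close>

definition admissible_scaling ::
  "(real \<Rightarrow> nat \<Rightarrow> real) \<Rightarrow> (real \<Rightarrow> nat \<Rightarrow> real) \<Rightarrow> bool" where
  "admissible_scaling \<sigma> \<tau> \<longleftrightarrow>
     (\<forall>\<beta>>0. \<forall>n\<ge>1. \<sigma> \<beta> n > 0 \<and> \<tau> \<beta> n > 0 \<and>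
        (1/2) * (\<sigma> \<beta> n)\<^sup>2 * \<tau> \<beta> n * (real n)\<^sup>2 = \<beta>)"

definition lyapunov_exponent ::
  "'a measure \<Rightarrow> (real \<Rightarrow> 'a \<Rightarrow> real) \<Rightarrow> (real \<Rightarrow> nat \<Rightarrow> real) \<Rightarrow> (real \<Rightarrow> nat \<Rightarrow> real) \<Rightarrow>
     real \<Rightarrow> real \<times> real \<Rightarrow> real" where
  "lyapunov_exponent M W \<sigma> \<tau> x0 = (\<lambda>(\<rho>, \<beta>).
     lim (\<lambda>n. ln (LINT \<omega>|M. growth_process W \<rho> (\<sigma> \<beta> n) (\<tau> \<beta> n) x0 n \<omega>) / real n))"

definition real_analytic_at :: "(real \<times> real \<Rightarrow> real) \<Rightarrow> real \<times> real \<Rightarrow> bool" where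
  "real_analytic_at f p \<longleftrightarrow>
     (\<exists>(c :: nat \<times> nat \<Rightarrow> real) r. r > 0 \<and>
        (\<forall>x y. \<bar>x - fst p\<bar> < r \<and> \<bar>y - snd p\<bar> < r \<longrightarrow>
           ((\<lambda>(i, j). c (i, j) * (x - fst p) ^ i * (y - snd p) ^ j) has_sum f (x, y)) UNIV))"

definition real_analytic_on :: "(real \<times> real \<Rightarrow> real) \<Rightarrow> (real \<times> real) set \<Rightarrow> bool" where
  "real_analytic_on f S \<longleftrightarrow> (\<forall>p\<in>S. real_analytic_at f p)"

definition parameter_space :: "(real \<times> real) set" where
  "parameter_space = {0<..} \<times> {0<..}"

definition analyticity_region :: "(real \<times> real \<Rightarrow> real) \<Rightarrow> (real \<times> real) set \<Rightarrow> bool" where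
  "analyticity_region f S \<longleftrightarrow>
     S \<noteq> {} \<and> open S \<and> connected S \<and> S \<subseteq> parameter_space \<and> real_analytic_on f S"

definition phase :: "(real \<times> real \<Rightarrow> real) \<Rightarrow> (real \<times> real) set \<Rightarrow> bool" where
  "phase f S \<longleftrightarrow>
     analyticity_region f S \<and> (\<forall>T. analyticity_region f T \<and> S \<subseteq> T \<longrightarrow> T = S)"

text \<open>
  A partial derivative of order \<open>j\<close> is named by a list of \<open>j\<close> coordinate directions; the head of the
  list is the direction of the outermost derivative. As \<^const>\<open>deriv\<close> is total, existence is a
  separate predicate.
\<close>

primrec partial :: "(real \<times> real) list \<Rightarrow> (real \<times> real \<Rightarrow> real) \<Rightarrow> real \<times> real \<Rightarrow> real" where
  "partial [] f = f"
| "partial (e # es) f = (\<lambda>p. deriv (\<lambda>t. partial es f (p + t *\<^sub>R e)) 0)"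

primrec partial_exists :: "(real \<times> real) list \<Rightarrow> (real \<times> real \<Rightarrow> real) \<Rightarrow> real \<times> real \<Rightarrow> bool" where
  "partial_exists [] f = (\<lambda>p. True)"
| "partial_exists (e # es) f = (\<lambda>p.
     (\<forall>\<^sub>F t in nhds 0. partial_exists es f (p + t *\<^sub>R e)) \<and>
     (\<lambda>t. partial es f (p + t *\<^sub>R e)) field_differentiable at 0)"

definition partial_continuous_at ::
  "(real \<times> real) list \<Rightarrow> (real \<times> real \<Rightarrow> real) \<Rightarrow> real \<times> real \<Rightarrow> bool" where
  "partial_continuous_at es f p \<longleftrightarrow>
     (\<forall>\<^sub>F q in nhds p. partial_exists es f q) \<and> isCont (partial es f) p"

text \<open>
  A derivative that jumps across a curve usually fails to exist on the curve itself, so a derivative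
  that does not exist near the point counts as discontinuous there.
\<close>

definition phase_transition :: "nat \<Rightarrow> (real \<times> real \<Rightarrow> real) \<Rightarrow> real \<times> real \<Rightarrow> bool" where
  "phase_transition j f p \<longleftrightarrow>
     p \<in> parameter_space \<and>
     (\<exists>S. phase f S \<and> p \<in> frontier S) \<and>
     (\<exists>es. set es \<subseteq> {(1, 0), (0, 1)} \<and> length es = j \<and> \<not> partial_continuous_at es f p) \<and>
     (\<forall>es. set es \<subseteq> {(1, 0), (0, 1)} \<and> length es < j \<longrightarrow> partial_continuous_at es f p)"

end

theory Submission
  imports Defs "HOL-Complex_Analysis.Complex_Analysis" "HOL-Real_Asymp.Real_Asymp"
begin

text \<open>
Expanding the product \<open>x\<^sub>n\<close> over the set \<open>S\<close> of indices at which the random term of the multiplier is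
  chosen, and using that \<open>W\<close> is Gaussian, turns \<open>E[x\<^sub>n] / x\<^sub>0\<close> into the partition function of a lattice
  gas of \<open>n\<close> sites with fugacity \<open>\<rho>\<close> and the attractive mean-field interaction
  \<open>\<beta> / n\<^sup>2 * (\<Sum>k<n. N\<^sub>k\<^sup>2)\<close>, where \<open>N\<^sub>k\<close> is the number of particles beyond \<open>k\<close>
  (\<open>expectation_growth_process\<close>). As \<open>N\<^sub>k / n\<close> is close to one of boundedly many step profiles, the
  squares can be linearised around a profile \<open>h\<close> at a cost that vanishes after taking \<open>ln\<close> and
  dividing by \<open>n\<close>. So the Lyapunov exponent is the limit of the maxima over \<open>h\<close> of an explicit energy
  (\<open>partition_function_ge\<close>, \<open>partition_function_le\<close>), and this limit exists because the maxima
  hardly change when the grid is refined (\<open>convergent_max_energy\<close>).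

  A stationary profile is a fixed point of the mean-field map, which sends \<open>h\<close> to the mean number of
  particles beyond \<open>k\<close> in the field that \<open>h\<close> produces. One step of this map never lowers the energy
  (\<open>energy_le_energy_mean_field_map\<close>). For \<open>\<rho> \<ge> 4\<close> the sites are so densely occupied that the map is
  a contraction, uniformly in \<open>n\<close> and, which is the point, in \<open>\<beta>\<close>: a large \<open>\<beta>\<close> makes the map
  more sensitive, but it also makes the vacancies exponentially rare
  (\<open>mean_field_map_contraction\<close>). Consequently the energy after \<open>n + 1\<close> steps from the profile \<open>0\<close>
  already has the Lyapunov exponent as its limit (\<open>lyapunov_exponent_mean_field\<close>).

  This energy is a composition of finitely many elementary functions of \<open>(\<rho>, \<beta>)\<close>. Its iterates keep
  the real part of the field nonnegative also for complex parameters near a real point with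
  \<open>\<rho> > 4\<close>, so it extends to a holomorphic function of two variables on a polydisc that does not depend
  on \<open>n\<close>, with a bound that does not depend on \<open>n\<close>
  (\<open>mean_field_energy_holomorphic\<close>, \<open>mean_field_energy_bound\<close>). A limit of such functions along the
  real points is given by a convergent double power series (\<open>real_analytic_at_limit\<close>), which is the
  claim with \<open>\<rho>\<^sub>c = 4\<close>. No phase transition can occur inside an analyticity region, since a maximal
  region with a boundary point there could be enlarged.
\<close>

section \<open>The expected growth as a partition function\<close>

definition exceedance :: "nat set \<Rightarrow> nat \<Rightarrow> nat" where
  "exceedance S k = card {i\<in>S. k < i}"

text \<open>
  The pair interaction \<open>\<Sum>i\<in>S. \<Sum>j\<in>S. min i j\<close> of the Gaussian covariance equals
  \<open>\<Sum>k<n. N\<^sub>k\<^sup>2\<close> with \<open>N\<^sub>k = exceedance S k\<close>, because \<open>min i j\<close> counts the \<open>k\<close> below both \<open>i\<close> and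
  \<open>j\<close>. Written as a sum of squares it can be linearised one square at a time.
\<close>

definition partition_function :: "real \<Rightarrow> real \<Rightarrow> nat \<Rightarrow> real" where
  "partition_function \<rho> c n =
     (\<Sum>S\<in>Pow {..<n}. \<rho> ^ card S *
        exp (c * ((\<Sum>k<n. (real (exceedance S k))\<^sup>2) - (\<Sum>i\<in>S. real i))))"

lemma sum_partial_sums_eq_exceedance:
  fixes a :: "nat \<Rightarrow> real"
  assumes "S \<subseteq> {..<n}"
  shows "(\<Sum>i\<in>S. \<Sum>k<i. a k) = (\<Sum>k<n. real (exceedance S k) * a k)"
proof -
  have fin: "finite S" using assms finite_subset by blast
  have "(\<Sum>i\<in>S. \<Sum>k<i. a k) = (\<Sum>i\<in>S. \<Sum>k<n. if k < i then a k else 0)"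
  proof (rule sum.cong[OF refl])
    fix i assume "i \<in> S"
    then have "{..<n} \<inter> {k. k < i} = {..<i}" using assms by auto
    then show "(\<Sum>k<i. a k) = (\<Sum>k<n. if k < i then a k else 0)"
      by (simp add: sum.If_cases)
  qed
  also have "\<dots> = (\<Sum>k<n. \<Sum>i\<in>S. if k < i then a k else 0)"
    by (rule sum.swap)
  also have "\<dots> = (\<Sum>k<n. real (exceedance S k) * a k)"
    using fin by (simp add: sum.If_cases exceedance_def Int_def)
  finally show ?thesis .
qed

text \<open>
  Completing the square: the exponential tilts the Gaussian density into the one with mean
  \<open>s * \<sigma>\<^sup>2\<close>, up to a constant factor.
\<close>

lemma normal_exponential_moment:
  fixes \<sigma> s :: real
  assumes "\<sigma> > 0"
  shows "integrable lborel (\<lambda>x. normal_density 0 \<sigma> x * exp (s * x))"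
    and "(\<integral>x. normal_density 0 \<sigma> x * exp (s * x) \<partial>lborel) = exp (s\<^sup>2 * \<sigma>\<^sup>2 / 2)"
proof -
  have eq: "normal_density 0 \<sigma> x * exp (s * x) = exp (s\<^sup>2 * \<sigma>\<^sup>2 / 2) * normal_density (s * \<sigma>\<^sup>2) \<sigma> x" for x
  proof -
    have "- x\<^sup>2 / (2 * \<sigma>\<^sup>2) + s * x = s\<^sup>2 * \<sigma>\<^sup>2 / 2 - (x - s * \<sigma>\<^sup>2)\<^sup>2 / (2 * \<sigma>\<^sup>2)"
      using assms by (simp add: field_simps power2_eq_square)
    then have "exp (- x\<^sup>2 / (2 * \<sigma>\<^sup>2)) * exp (s * x)
        = exp (s\<^sup>2 * \<sigma>\<^sup>2 / 2) * exp (- (x - s * \<sigma>\<^sup>2)\<^sup>2 / (2 * \<sigma>\<^sup>2))"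
      by (simp flip: exp_add)
    then show ?thesis
      by (simp add: normal_density_def)
  qed
  show "integrable lborel (\<lambda>x. normal_density 0 \<sigma> x * exp (s * x))"
    unfolding eq using assms by simp
  show "(\<integral>x. normal_density 0 \<sigma> x * exp (s * x) \<partial>lborel) = exp (s\<^sup>2 * \<sigma>\<^sup>2 / 2)"
    unfolding eq using assms by simp
qed

lemma growth_process_eq_prod:
  "growth_process W \<rho> \<sigma> \<tau> x0 n \<omega> = x0 * (\<Prod>i<n. multiplier W \<rho> \<sigma> \<tau> i \<omega>)"
  by (induction n) (simp_all add: mult_ac)

lemma brownian_exponential_moment:
  assumes "standard_brownian_motion M W" and "\<tau> > 0"
  shows "integrable M (\<lambda>\<omega>. exp (\<Sum>k<n. b k * (W (real (Suc k) * \<tau>) \<omega> - W (real k * \<tau>) \<omega>)))"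
    and "(\<integral>\<omega>. exp (\<Sum>k<n. b k * (W (real (Suc k) * \<tau>) \<omega> - W (real k * \<tau>) \<omega>)) \<partial>M)
           = exp (\<tau> / 2 * (\<Sum>k<n. (b k)\<^sup>2))"
proof -
  interpret prob_space M using assms(1) by (simp add: standard_brownian_motion_def)
  define X where "X = (\<lambda>k \<omega>. W (real (Suc k) * \<tau>) \<omega> - W (real k * \<tau>) \<omega>)"
  have mono: "strict_mono_on {..n} (\<lambda>k. real k * \<tau>)"
    using \<open>\<tau> > 0\<close> by (auto simp: strict_mono_on_def)
  have indep: "indep_vars (\<lambda>_. borel) X {..<n}"
  proof -
    have "\<forall>(t :: nat \<Rightarrow> real) k. 0 \<le> t 0 \<and> strict_mono_on {..k} t \<longrightarrow>
        indep_vars (\<lambda>_. borel) (\<lambda>i \<omega>. W (t (Suc i)) \<omega> - W (t i) \<omega>) {..<k}"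
      using assms(1) unfolding standard_brownian_motion_def by (elim conjE) assumption
    from this[rule_format, of "\<lambda>k. real k * \<tau>" n] show ?thesis
      using mono unfolding X_def by simp
  qed
  have dist: "distributed M lborel (X k) (normal_density 0 (sqrt \<tau>))" for k
  proof -
    have "real (Suc k) * \<tau> - real k * \<tau> = \<tau>" by (simp add: algebra_simps)
    moreover have "\<forall>s t. 0 \<le> s \<and> s < t \<longrightarrow>
        distributed M lborel (\<lambda>\<omega>. W t \<omega> - W s \<omega>) (normal_density 0 (sqrt (t - s)))"
      using assms(1) unfolding standard_brownian_motion_def by (elim conjE) assumption
    then have "distributed M lborel (X k) (normal_density 0 (sqrt (real (Suc k) * \<tau> - real k * \<tau>)))"
      unfolding X_def using \<open>\<tau> > 0\<close> by auto
    ultimately show ?thesis by (simp only:)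
  qed
  have int: "integrable M (\<lambda>\<omega>. exp (b k * X k \<omega>))" for k
    using normal_exponential_moment(1)[of "sqrt \<tau>" "b k"] \<open>\<tau> > 0\<close>
    by (subst distributed_integrable[OF dist, symmetric]) auto
  have val: "(\<integral>\<omega>. exp (b k * X k \<omega>) \<partial>M) = exp (\<tau> / 2 * (b k)\<^sup>2)" for k
    using normal_exponential_moment(2)[of "sqrt \<tau>" "b k"] \<open>\<tau> > 0\<close>
    by (subst distributed_integral[OF dist, symmetric]) (auto simp: mult_ac)
  have ind: "indep_vars (\<lambda>_. borel) (\<lambda>k \<omega>. exp (b k * X k \<omega>)) {..<n}"
    by (rule indep_vars_compose2[OF indep]) auto
  have eq: "exp (\<Sum>k<n. b k * X k \<omega>) = (\<Prod>k<n. exp (b k * X k \<omega>))" for \<omega>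
    by (simp add: exp_sum)
  show "integrable M (\<lambda>\<omega>. exp (\<Sum>k<n. b k * (W (real (Suc k) * \<tau>) \<omega> - W (real k * \<tau>) \<omega>)))"
    using indep_vars_integrable[OF _ ind int] eq by (simp add: X_def)
  have "(\<integral>\<omega>. exp (\<Sum>k<n. b k * X k \<omega>) \<partial>M) = (\<Prod>k<n. exp (\<tau> / 2 * (b k)\<^sup>2))"
    unfolding eq using indep_vars_lebesgue_integral[OF _ ind int] by (simp add: val)
  also have "\<dots> = exp (\<tau> / 2 * (\<Sum>k<n. (b k)\<^sup>2))"
    by (simp add: sum_distrib_left exp_sum)
  finally show "(\<integral>\<omega>. exp (\<Sum>k<n. b k * (W (real (Suc k) * \<tau>) \<omega> - W (real k * \<tau>) \<omega>)) \<partial>M)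
           = exp (\<tau> / 2 * (\<Sum>k<n. (b k)\<^sup>2))"
    unfolding X_def .
qed

text \<open>
  For each \<open>S\<close> the exponent \<open>\<Sum>i\<in>S. W (i \<tau>)\<close> is a combination of independent increments, in which
  the increment number \<open>k\<close> has the coefficient \<open>exceedance S k\<close>; its exponential moment produces
  the squares.
\<close>

lemma expectation_growth_process:
  assumes bm: "standard_brownian_motion M W" and "\<tau> > 0"
  shows "(\<integral>\<omega>. growth_process W \<rho> \<sigma> \<tau> x0 n \<omega> \<partial>M) = x0 * partition_function \<rho> (\<sigma>\<^sup>2 * \<tau> / 2) n"
proof -
  interpret prob_space M using bm by (simp add: standard_brownian_motion_def)
  define X where "X = (\<lambda>k \<omega>. W (real (Suc k) * \<tau>) \<omega> - W (real k * \<tau>) \<omega>)"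
  define G where "G = (\<lambda>S \<omega>. exp (\<Sum>k<n. (\<sigma> * real (exceedance S k)) * X k \<omega>))"
  define w where "w = (\<lambda>S. \<rho> ^ card S * exp (- (\<sigma>\<^sup>2 * \<tau> / 2) * (\<Sum>i\<in>S. real i)))"
  have intG: "integrable M (G S)" for S
    unfolding G_def X_def by (rule brownian_exponential_moment[OF bm \<open>\<tau> > 0\<close>])
  have valG: "(\<integral>\<omega>. G S \<omega> \<partial>M) = exp (\<sigma>\<^sup>2 * \<tau> / 2 * (\<Sum>k<n. (real (exceedance S k))\<^sup>2))" for S
    unfolding G_def X_def brownian_exponential_moment(2)[OF bm \<open>\<tau> > 0\<close>]
    by (simp add: power_mult_distrib sum_distrib_left mult_ac)
  have W0: "AE \<omega> in M. W 0 \<omega> = 0" using bm by (simp add: standard_brownian_motion_def)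
  have expand: "growth_process W \<rho> \<sigma> \<tau> x0 n \<omega> = x0 * (\<Sum>S\<in>Pow {..<n}. w S * G S \<omega>)"
    if "W 0 \<omega> = 0" for \<omega>
  proof -
    have Wi: "W (real i * \<tau>) \<omega> = (\<Sum>k<i. X k \<omega>)" for i
      using that sum_lessThan_telescope[of "\<lambda>k. W (real k * \<tau>) \<omega>" i] by (simp add: X_def)
    have "(\<Prod>i<n. multiplier W \<rho> \<sigma> \<tau> i \<omega>)
        = (\<Prod>i<n. \<rho> * exp (\<sigma> * W (real i * \<tau>) \<omega> - \<sigma>\<^sup>2 * (real i * \<tau>) / 2) + 1)"
      by (simp add: multiplier_def add.commute)
    also have "\<dots> = (\<Sum>S\<in>Pow {..<n}. \<Prod>i\<in>S. \<rho> * exp (\<sigma> * W (real i * \<tau>) \<omega> - \<sigma>\<^sup>2 * (real i * \<tau>) / 2))"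
      by (subst prod_add) auto
    also have "\<dots> = (\<Sum>S\<in>Pow {..<n}. w S * G S \<omega>)"
    proof (rule sum.cong[OF refl])
      fix S assume "S \<in> Pow {..<n}"
      then have S: "S \<subseteq> {..<n}" and fin: "finite S" using finite_subset by auto
      have "(\<Sum>i\<in>S. \<sigma> * W (real i * \<tau>) \<omega>) = (\<Sum>k<n. (\<sigma> * real (exceedance S k)) * X k \<omega>)"
        by (simp add: Wi sum_partial_sums_eq_exceedance[OF S] sum_distrib_left[symmetric] mult.assoc)
      moreover have "(\<Sum>i\<in>S. \<sigma>\<^sup>2 * (real i * \<tau>) / 2) = \<sigma>\<^sup>2 * \<tau> / 2 * (\<Sum>i\<in>S. real i)"
        unfolding sum_distrib_left by (rule sum.cong) auto
      ultimately have "(\<Sum>i\<in>S. \<sigma> * W (real i * \<tau>) \<omega> - \<sigma>\<^sup>2 * (real i * \<tau>) / 2)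
          = (\<Sum>k<n. (\<sigma> * real (exceedance S k)) * X k \<omega>) - \<sigma>\<^sup>2 * \<tau> / 2 * (\<Sum>i\<in>S. real i)"
        by (simp add: sum_subtractf)
      then show "(\<Prod>i\<in>S. \<rho> * exp (\<sigma> * W (real i * \<tau>) \<omega> - \<sigma>\<^sup>2 * (real i * \<tau>) / 2)) = w S * G S \<omega>"
        using fin by (simp add: prod.distrib exp_sum[symmetric] w_def G_def exp_add[symmetric])
    qed
    finally show ?thesis by (simp add: growth_process_eq_prod)
  qed
  have Wmeas[measurable]: "W (real i * \<tau>) \<in> borel_measurable M" for i
    using bm \<open>\<tau> > 0\<close> by (simp add: standard_brownian_motion_def)
  have meas: "(\<lambda>\<omega>. growth_process W \<rho> \<sigma> \<tau> x0 n \<omega>) \<in> borel_measurable M"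
    unfolding growth_process_eq_prod multiplier_def by measurable
  have "(\<integral>\<omega>. growth_process W \<rho> \<sigma> \<tau> x0 n \<omega> \<partial>M) = (\<integral>\<omega>. x0 * (\<Sum>S\<in>Pow {..<n}. w S * G S \<omega>) \<partial>M)"
    using W0 expand meas intG by (intro integral_cong_AE) auto
  also have "\<dots> = x0 * (\<Sum>S\<in>Pow {..<n}. w S * (\<integral>\<omega>. G S \<omega> \<partial>M))"
    using intG by simp
  also have "\<dots> = x0 * partition_function \<rho> (\<sigma>\<^sup>2 * \<tau> / 2) n"
    unfolding partition_function_def valG w_def
    by (simp add: mult.assoc exp_add[symmetric] right_diff_distrib)
  finally show ?thesis .
qed

section \<open>The energy of a profile and the mean-field map\<close>

definition potential :: "'a::real_normed_field \<Rightarrow> nat \<Rightarrow> (nat \<Rightarrow> 'a) \<Rightarrow> nat \<Rightarrow> 'a" where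
  "potential \<beta> n h i = 2 * \<beta> / of_nat n * (\<Sum>k<i. h k)"

text \<open>
  The mean occupation of site \<open>i\<close> in the field of \<open>h\<close>, that is the logistic function of
  \<open>ln \<rho> + potential \<beta> n h i\<close>. This form of it has no singularity while the vacancy weight
  \<open>exp (- potential) / \<rho>\<close> is small, which also covers the complex parameters used below.
\<close>

definition occupation ::
  "'a::{real_normed_field,banach} \<Rightarrow> 'a \<Rightarrow> nat \<Rightarrow> (nat \<Rightarrow> 'a) \<Rightarrow> nat \<Rightarrow> 'a" where
  "occupation \<rho> \<beta> n h i = 1 / (1 + exp (- potential \<beta> n h i) / \<rho>)"

definition mean_field_map ::
  "'a::{real_normed_field,banach} \<Rightarrow> 'a \<Rightarrow> nat \<Rightarrow> (nat \<Rightarrow> 'a) \<Rightarrow> nat \<Rightarrow> 'a" where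
  "mean_field_map \<rho> \<beta> n h k = (\<Sum>i=Suc k..<n. occupation \<rho> \<beta> n h i) / of_nat n"

text \<open>
  For real \<open>\<rho> > 0\<close> and \<open>n > 0\<close> the first two terms are the mean over the sites of
  \<open>ln (1 + \<rho> * exp (potential \<beta> n h i))\<close> (\<open>real_energy_eq\<close>). Splitting off \<open>ln \<rho>\<close> and the potential
  leaves a logarithm of a number close to \<open>1\<close>, so that the same formula is holomorphic for complex
  parameters with the principal branch of the logarithm.
\<close>

definition energy ::
  "'a::{real_normed_field,banach,ln} \<Rightarrow> 'a \<Rightarrow> nat \<Rightarrow> (nat \<Rightarrow> 'a) \<Rightarrow> 'a" where
  "energy \<rho> \<beta> n h =
     ln \<rho> + (\<Sum>i<n. potential \<beta> n h i + ln (1 + exp (- potential \<beta> n h i) / \<rho>)) / of_nat n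
     - \<beta> * (\<Sum>k<n. (h k)\<^sup>2) / of_nat n"

lemma ln_one_plus_exp_eq:
  fixes \<rho> v :: real
  assumes "\<rho> > 0"
  shows "ln (1 + \<rho> * exp v) = ln \<rho> + v + ln (1 + exp (- v) / \<rho>)"
proof -
  have "1 + \<rho> * exp v = \<rho> * (exp v * (1 + exp (- v) / \<rho>))"
    using assms by (simp add: field_simps exp_minus)
  moreover have "1 + exp (- v) / \<rho> > 0"
    using assms by (simp add: add_pos_pos)
  ultimately show ?thesis
    using assms by (simp add: ln_mult)
qed

lemma real_energy_eq:
  fixes \<rho> \<beta> :: real
  assumes "\<rho> > 0" "n > 0"
  shows "real n * energy \<rho> \<beta> n h
    = (\<Sum>i<n. ln (1 + \<rho> * exp (potential \<beta> n h i))) - \<beta> * (\<Sum>k<n. (h k)\<^sup>2)"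
proof -
  have "(\<Sum>i<n. ln (1 + \<rho> * exp (potential \<beta> n h i)))
      = real n * ln \<rho> + (\<Sum>i<n. potential \<beta> n h i + ln (1 + exp (- potential \<beta> n h i) / \<rho>))"
    using assms by (simp add: ln_one_plus_exp_eq sum.distrib)
  then show ?thesis
    using assms by (simp add: energy_def field_simps)
qed

lemma inverse_one_plus_bounds:
  fixes x :: real
  assumes "0 \<le> x"
  shows "0 \<le> 1 / (1 + x)" "1 / (1 + x) \<le> 1"
  using assms by (auto simp: divide_le_eq)

lemma occupation_bounds:
  fixes \<rho> \<beta> :: real
  assumes "\<rho> > 0"
  shows "0 \<le> occupation \<rho> \<beta> n h i" "occupation \<rho> \<beta> n h i \<le> 1"
  using assms inverse_one_plus_bounds[of "exp (- potential \<beta> n h i) / \<rho>"]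
  by (auto simp: occupation_def)

text \<open>
  The occupation is the slope of the convex function \<open>v \<mapsto> ln (1 + \<rho> * exp v)\<close>. With \<open>p\<close> the
  occupation at \<open>v\<close>, the quotient \<open>(1 + \<rho> * exp w) / (1 + \<rho> * exp v)\<close> is the convex combination
  \<open>(1 - p) + p * exp (w - v)\<close>, to which convexity of \<open>exp\<close> applies.
\<close>

lemma ln_one_plus_exp_above_tangent:
  fixes \<rho> v w :: real
  assumes "\<rho> > 0"
  shows "ln (1 + \<rho> * exp v) + 1 / (1 + exp (- v) / \<rho>) * (w - v) \<le> ln (1 + \<rho> * exp w)"
proof -
  define p where "p = 1 / (1 + exp (- v) / \<rho>)"
  have p: "0 \<le> p" "p \<le> 1"
    using assms inverse_one_plus_bounds[of "exp (- v) / \<rho>"] by (auto simp: p_def)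
  have pos: "0 < 1 + \<rho> * exp v" "0 < 1 + \<rho> * exp w" using assms by (auto intro: add_pos_pos)
  have "exp (p * (w - v)) \<le> (1 - p) + p * exp (w - v)"
    using convex_onD[OF exp_convex, of p 0 "w - v"] p by simp
  also have "\<dots> = (1 + \<rho> * exp w) / (1 + \<rho> * exp v)"
  proof -
    have p_eq: "p = \<rho> * exp v / (1 + \<rho> * exp v)"
      using assms pos by (simp add: p_def exp_minus field_simps)
    have "p * exp (w - v) = \<rho> * (exp v * exp (w - v)) / (1 + \<rho> * exp v)"
      by (simp add: p_eq)
    also have "exp v * exp (w - v) = exp w" by (simp flip: exp_add)
    finally have "p * exp (w - v) = \<rho> * exp w / (1 + \<rho> * exp v)" .
    moreover have "1 - p = 1 / (1 + \<rho> * exp v)"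
      using pos by (simp add: p_eq field_simps)
    ultimately show ?thesis by (simp add: add_divide_distrib)
  qed
  finally have "p * (w - v) \<le> ln ((1 + \<rho> * exp w) / (1 + \<rho> * exp v))"
    using pos by (subst ln_ge_iff) auto
  then show ?thesis
    using pos by (simp add: ln_div p_def)
qed

lemma ln_one_plus_exp_mono:
  fixes \<rho> v w :: real
  assumes "\<rho> > 0" "v \<le> w"
  shows "ln (1 + \<rho> * exp v) \<le> ln (1 + \<rho> * exp w)"
  using assms by (intro ln_mono) (auto intro: add_pos_pos)

lemma ln_one_plus_exp_increment:
  fixes \<rho> v w :: real
  assumes "\<rho> > 0" "w \<le> v + d" "0 \<le> d"
  shows "ln (1 + \<rho> * exp w) \<le> ln (1 + \<rho> * exp v) + d"
proof -
  have "1 + \<rho> * exp (v + d) \<le> (1 + \<rho> * exp v) * exp d"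
    using assms by (simp add: exp_add algebra_simps)
  then have "ln (1 + \<rho> * exp (v + d)) \<le> ln ((1 + \<rho> * exp v) * exp d)"
    using assms by (intro ln_mono) (auto intro: add_pos_pos)
  also have "\<dots> = ln (1 + \<rho> * exp v) + d"
    using assms by (subst ln_mult) (auto intro: add_pos_pos simp: add_pos_pos less_imp_neq[symmetric])
  finally show ?thesis
    using ln_one_plus_exp_mono[OF assms(1,2)] by linarith
qed

lemma sum_partial_sums_swap:
  fixes a b :: "nat \<Rightarrow> 'a::comm_ring"
  shows "(\<Sum>i<n. a i * (\<Sum>k<i. b k)) = (\<Sum>k<n. b k * (\<Sum>i=Suc k..<n. a i))"
proof -
  have "(\<Sum>i<n. a i * (\<Sum>k<i. b k)) = (\<Sum>i<n. \<Sum>k<n. if k < i then a i * b k else 0)"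
  proof (rule sum.cong[OF refl])
    fix i assume "i \<in> {..<n}"
    then have "{..<n} \<inter> {k. k < i} = {..<i}" by auto
    then show "a i * (\<Sum>k<i. b k) = (\<Sum>k<n. if k < i then a i * b k else 0)"
      by (simp add: sum.If_cases sum_distrib_left)
  qed
  also have "\<dots> = (\<Sum>k<n. \<Sum>i<n. if k < i then a i * b k else 0)"
    by (rule sum.swap)
  also have "\<dots> = (\<Sum>k<n. b k * (\<Sum>i=Suc k..<n. a i))"
  proof (rule sum.cong[OF refl])
    fix k
    have "{..<n} \<inter> {i. k < i} = {Suc k..<n}" by auto
    then show "(\<Sum>i<n. if k < i then a i * b k else 0) = b k * (\<Sum>i=Suc k..<n. a i)"
      by (simp add: sum.If_cases sum_distrib_left mult_ac)
  qed
  finally show ?thesis .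
qed

text \<open>
  With \<open>g\<close> the image of \<open>h\<close>, the tangent inequality at the field of \<open>h\<close> bounds the gain of the
  logarithmic part below by \<open>2 * \<beta> * (\<Sum>k<n. (g k - h k) * g k)\<close>, since the tails of the
  occupations are \<open>n * g k\<close>. Together with the change of the quadratic part this leaves the square
  \<open>\<beta> * (\<Sum>k<n. (g k - h k)\<^sup>2)\<close>.
\<close>

lemma energy_le_energy_mean_field_map:
  fixes \<rho> \<beta> :: real
  assumes "\<rho> > 0" "\<beta> \<ge> 0"
  shows "energy \<rho> \<beta> n h \<le> energy \<rho> \<beta> n (mean_field_map \<rho> \<beta> n h)"
proof (cases "n = 0")
  case True
  then show ?thesis by (simp add: energy_def)
next
  case False
  define g where "g = mean_field_map \<rho> \<beta> n h"
  define p where "p = occupation \<rho> \<beta> n h"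
  have tail: "(\<Sum>i=Suc k..<n. p i) = real n * g k" for k
    using False by (simp add: g_def p_def mean_field_map_def)
  have diff: "potential \<beta> n g i - potential \<beta> n h i = 2 * \<beta> / n * (\<Sum>k<i. g k - h k)" for i
    by (simp add: potential_def sum_subtractf algebra_simps)
  have "(\<Sum>i<n. p i * (potential \<beta> n g i - potential \<beta> n h i))
      = 2 * \<beta> / n * (\<Sum>i<n. p i * (\<Sum>k<i. g k - h k))"
    unfolding diff by (simp add: sum_distrib_left mult_ac)
  also have "\<dots> = 2 * \<beta> * (\<Sum>k<n. (g k - h k) * g k)"
    unfolding sum_partial_sums_swap tail using False by (simp add: sum_distrib_left mult_ac)
  finally have gain: "(\<Sum>i<n. p i * (potential \<beta> n g i - potential \<beta> n h i))
      = 2 * \<beta> * (\<Sum>k<n. (g k - h k) * g k)" .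
  have "(\<Sum>i<n. ln (1 + \<rho> * exp (potential \<beta> n h i)) + p i * (potential \<beta> n g i - potential \<beta> n h i))
      \<le> (\<Sum>i<n. ln (1 + \<rho> * exp (potential \<beta> n g i)))"
    unfolding p_def occupation_def
    by (intro sum_mono ln_one_plus_exp_above_tangent assms)
  then have "real n * energy \<rho> \<beta> n h + 2 * \<beta> * (\<Sum>k<n. (g k - h k) * g k)
      + \<beta> * (\<Sum>k<n. (h k)\<^sup>2) - \<beta> * (\<Sum>k<n. (g k)\<^sup>2) \<le> real n * energy \<rho> \<beta> n g"
    using False assms by (simp add: real_energy_eq sum.distrib gain)
  moreover have "2 * \<beta> * (\<Sum>k<n. (g k - h k) * g k) + \<beta> * (\<Sum>k<n. (h k)\<^sup>2) - \<beta> * (\<Sum>k<n. (g k)\<^sup>2)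
      = \<beta> * (\<Sum>k<n. (g k - h k)\<^sup>2)"
    by (simp add: sum_distrib_left sum_subtractf[symmetric] sum.distrib[symmetric])
      (intro sum.cong refl, simp add: power2_eq_square algebra_simps)
  moreover have "0 \<le> \<beta> * (\<Sum>k<n. (g k - h k)\<^sup>2)"
    using assms by (simp add: sum_nonneg)
  ultimately have "real n * energy \<rho> \<beta> n h \<le> real n * energy \<rho> \<beta> n g" by linarith
  then show ?thesis using False by (simp add: g_def)
qed

section \<open>The energy and the partition function\<close>

text \<open>
  The exponential of the energy is the partition function with every square \<open>N\<^sub>k\<^sup>2\<close> replaced by its
  tangent at \<open>n * h k\<close>; the exponent
  loses exactly \<open>\<beta>\<close> times the squared distance of \<open>N\<^sub>k / n\<close> to \<open>h k\<close>, summed over \<open>k\<close>. The self-energy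
  \<open>- \<beta> / n\<^sup>2 * (\<Sum>i\<in>S. i)\<close> is absent here; it changes the exponent of the partition function by at
  most \<open>\<beta>\<close>.
\<close>

lemma exp_energy_eq:
  fixes \<rho> \<beta> :: real
  assumes "\<rho> > 0" "n > 0"
  shows "exp (real n * energy \<rho> \<beta> n h)
    = (\<Sum>S\<in>Pow {..<n}. \<rho> ^ card S *
         exp (\<beta> / (real n)\<^sup>2 * (\<Sum>k<n. (real (exceedance S k))\<^sup>2)
              - \<beta> * (\<Sum>k<n. (real (exceedance S k) / n - h k)\<^sup>2)))"
proof -
  have "exp (\<Sum>i<n. ln (1 + \<rho> * exp (potential \<beta> n h i))) = (\<Prod>i<n. \<rho> * exp (potential \<beta> n h i) + 1)"
    using assms by (simp add: exp_sum add_pos_pos add.commute)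
  also have "\<dots> = (\<Sum>S\<in>Pow {..<n}. \<Prod>i\<in>S. \<rho> * exp (potential \<beta> n h i))"
    by (subst prod_add) auto
  also have "\<dots> = (\<Sum>S\<in>Pow {..<n}. \<rho> ^ card S * exp (\<Sum>i\<in>S. potential \<beta> n h i))"
    by (intro sum.cong refl) (auto simp: prod.distrib exp_sum finite_subset)
  finally have "exp (real n * energy \<rho> \<beta> n h)
      = (\<Sum>S\<in>Pow {..<n}. \<rho> ^ card S * exp ((\<Sum>i\<in>S. potential \<beta> n h i) - \<beta> * (\<Sum>k<n. (h k)\<^sup>2)))"
    using assms by (simp add: real_energy_eq exp_diff sum_divide_distrib)
  also have "\<dots> = (\<Sum>S\<in>Pow {..<n}. \<rho> ^ card S *
         exp (\<beta> / (real n)\<^sup>2 * (\<Sum>k<n. (real (exceedance S k))\<^sup>2)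
              - \<beta> * (\<Sum>k<n. (real (exceedance S k) / n - h k)\<^sup>2)))"
  proof (rule sum.cong[OF refl])
    fix S assume "S \<in> Pow {..<n}"
    then have S: "S \<subseteq> {..<n}" by simp
    have "(\<Sum>i\<in>S. potential \<beta> n h i) = (\<Sum>k<n. 2 * \<beta> / n * (real (exceedance S k) * h k))"
      unfolding potential_def sum_distrib_left[symmetric] sum_partial_sums_eq_exceedance[OF S] ..
    moreover have "2 * \<beta> / n * (real (exceedance S k) * h k) - \<beta> * (h k)\<^sup>2
      = \<beta> / (real n)\<^sup>2 * (real (exceedance S k))\<^sup>2 - \<beta> * (real (exceedance S k) / n - h k)\<^sup>2" for k
      using assms by (simp add: field_simps power2_eq_square)
    ultimately have "(\<Sum>i\<in>S. potential \<beta> n h i) - \<beta> * (\<Sum>k<n. (h k)\<^sup>2)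
      = \<beta> / (real n)\<^sup>2 * (\<Sum>k<n. (real (exceedance S k))\<^sup>2)
              - \<beta> * (\<Sum>k<n. (real (exceedance S k) / n - h k)\<^sup>2)"
      by (simp add: sum_distrib_left sum_subtractf[symmetric])
    then show "\<rho> ^ card S * exp ((\<Sum>i\<in>S. potential \<beta> n h i) - \<beta> * (\<Sum>k<n. (h k)\<^sup>2))
      = \<rho> ^ card S *
         exp (\<beta> / (real n)\<^sup>2 * (\<Sum>k<n. (real (exceedance S k))\<^sup>2)
              - \<beta> * (\<Sum>k<n. (real (exceedance S k) / n - h k)\<^sup>2))" by simp
  qed
  finally show ?thesis .
qed

lemma partition_function_ge:
  fixes \<rho> \<beta> :: real
  assumes "\<rho> > 0" "\<beta> \<ge> 0" "n > 0"
  shows "exp (real n * energy \<rho> \<beta> n h - \<beta>) \<le> partition_function \<rho> (\<beta> / (real n)\<^sup>2) n"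
proof -
  have "exp (real n * energy \<rho> \<beta> n h) \<le> exp \<beta> * partition_function \<rho> (\<beta> / (real n)\<^sup>2) n"
    unfolding exp_energy_eq[OF assms(1,3)] partition_function_def sum_distrib_left[of "exp \<beta>"]
  proof (rule sum_mono)
    fix S assume "S \<in> Pow {..<n}"
    then have S: "S \<subseteq> {..<n}" by simp
    then have cS: "card S \<le> n" using card_mono[of "{..<n}" S] by simp
    have "(\<Sum>i\<in>S. real i) \<le> real (card S) * real n"
      by (rule sum_bounded_above) (use S in auto)
    also have "\<dots> \<le> (real n)\<^sup>2"
      using cS by (simp add: power2_eq_square mult_right_mono)
    finally have "\<beta> / (real n)\<^sup>2 * (\<Sum>i\<in>S. real i) \<le> \<beta> / (real n)\<^sup>2 * (real n)\<^sup>2"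
      using assms by (intro mult_left_mono) auto
    also have "\<dots> = \<beta>" using assms by simp
    finally have "\<beta> / (real n)\<^sup>2 * (\<Sum>k<n. (real (exceedance S k))\<^sup>2)
              - \<beta> * (\<Sum>k<n. (real (exceedance S k) / n - h k)\<^sup>2)
        \<le> \<beta> + \<beta> / (real n)\<^sup>2 * ((\<Sum>k<n. (real (exceedance S k))\<^sup>2) - (\<Sum>i\<in>S. real i))"
      using mult_nonneg_nonneg[OF assms(2) sum_nonneg[of "{..<n}" "\<lambda>k. (real (exceedance S k) / n - h k)\<^sup>2"]]
      by (simp add: right_diff_distrib)
    then show "\<rho> ^ card S *
         exp (\<beta> / (real n)\<^sup>2 * (\<Sum>k<n. (real (exceedance S k))\<^sup>2)
              - \<beta> * (\<Sum>k<n. (real (exceedance S k) / n - h k)\<^sup>2))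
       \<le> exp \<beta> * (\<rho> ^ card S *
        exp (\<beta> / (real n)\<^sup>2 * ((\<Sum>k<n. (real (exceedance S k))\<^sup>2) - (\<Sum>i\<in>S. real i))))"
      using assms by (simp add: mult.left_commute[of "exp \<beta>"] exp_add[symmetric])
  qed
  then show ?thesis by (simp add: exp_diff field_simps)
qed

lemma exceedance_le:
  assumes "S \<subseteq> {..<n}"
  shows "exceedance S k \<le> n"
  unfolding exceedance_def using card_mono[of "{..<n}" "{i\<in>S. k < i}"] assms by auto

lemma exceedance_antimono:
  assumes "finite S" "j \<le> k"
  shows "exceedance S k \<le> exceedance S j"
  unfolding exceedance_def using assms by (intro card_mono) auto

lemma exceedance_decrement:
  assumes "finite S" "j \<le> k"
  shows "exceedance S j \<le> exceedance S k + (k - j)"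
proof -
  have "exceedance S j \<le> card ({i\<in>S. k < i} \<union> {j<..k})"
    unfolding exceedance_def using assms by (intro card_mono) auto
  also have "\<dots> \<le> exceedance S k + card {j<..k}"
    unfolding exceedance_def by (rule card_Un_le)
  finally show ?thesis by simp
qed

definition unit_profiles :: "(nat \<Rightarrow> real) set" where
  "unit_profiles = {h. \<forall>k. 0 \<le> h k \<and> h k \<le> 1}"

text \<open>
  The index \<open>k\<close> is sent to its block among \<open>L\<close> blocks of about \<open>n / L\<close> consecutive indices, and \<open>a\<close>
  assigns to each block a multiple of \<open>1 / L\<close>. The number of such profiles does not depend on \<open>n\<close>.
\<close>

definition step_profile :: "nat \<Rightarrow> nat \<Rightarrow> (nat \<Rightarrow> nat) \<Rightarrow> nat \<Rightarrow> real" where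
  "step_profile L n a k = (if k < n then real (a (k * L div n)) / real L else 0)"

text \<open>
  The exceedance is monotone and changes by at most one per index, so it is determined up to about
  \<open>n / L\<close> by its values at the \<open>L\<close> block starts; rounding these values costs another \<open>n / L\<close>, in the
  opposite direction.
\<close>

lemma step_profile_approximates:
  assumes S: "S \<subseteq> {..<n}" and L: "0 < L" "L \<le> n"
  obtains a where "a \<in> {..<L} \<rightarrow>\<^sub>E {..L}"
    and "\<And>k. k < n \<Longrightarrow> \<bar>real (exceedance S k) / n - step_profile L n a k\<bar> \<le> 2 / real L"
proof
  define a where "a = restrict (\<lambda>j. L * exceedance S (j * n div L) div n) {..<L}"
  have n: "n > 0" and fin: "finite S" using assms finite_subset by auto
  show "a \<in> {..<L} \<rightarrow>\<^sub>E {..L}"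
  proof (rule PiE_I)
    fix j assume "j \<in> {..<L}"
    have "L * exceedance S (j * n div L) div n \<le> L * n div n"
      using exceedance_le[OF S] by (intro div_le_mono mult_left_mono) auto
    then show "a j \<in> {..L}" using n \<open>j \<in> {..<L}\<close> by (simp add: a_def)
  qed (simp add: a_def)
  fix k assume "k < n"
  define j where "j = k * L div n"
  define r where "r = j * n div L"
  have j: "j < L" unfolding j_def using \<open>k < n\<close> n L
    by (simp add: div_less_iff_less_mult mult.commute)
  have jn: "j * n \<le> k * L" unfolding j_def by (simp add: div_times_less_eq_dividend)
  have kj: "k * L < (j + 1) * n"
    unfolding j_def using n by (metis Suc_eq_plus1 dividend_less_div_times mult.commute mult_Suc)
  have "r \<le> k * L div L" unfolding r_def by (rule div_le_mono[OF jn])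
  then have rk: "r \<le> k" using L by simp
  have rj: "j * n < (r + 1) * L"
    unfolding r_def using L by (metis Suc_eq_plus1 dividend_less_div_times mult.commute mult_Suc)
  define N where "N = exceedance S r"
  have s: "step_profile L n a k = real (L * N div n) / L"
    using \<open>k < n\<close> j by (simp add: step_profile_def a_def j_def[symmetric] r_def[symmetric] N_def)
  have q: "real (L * N div n) \<le> real L * N / n" "real L * N / n - 1 < real (L * N div n)"
  proof -
    have "(L * N div n) * n \<le> L * N" "L * N < (L * N div n) * n + n"
      using n by (simp_all add: div_times_less_eq_dividend add.commute dividend_less_div_times)
    then have "real (L * N div n) * n \<le> real L * N" "real L * N < real (L * N div n) * n + n"
      by (metis of_nat_le_iff of_nat_mult, metis of_nat_add of_nat_less_iff of_nat_mult)
    then show "real (L * N div n) \<le> real L * N / n" "real L * N / n - 1 < real (L * N div n)"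
      using n by (simp_all add: field_simps)
  qed
  have s_up: "step_profile L n a k \<le> real N / n"
    unfolding s using q(1) L by (simp add: field_simps)
  have s_lo: "real N / n - 1 / L \<le> step_profile L n a k"
  proof -
    have "(real L * N / n - 1) / L \<le> real (L * N div n) / L"
      using q(2) by (intro divide_right_mono) auto
    then show ?thesis unfolding s using L by (simp add: diff_divide_distrib)
  qed
  have N1: "exceedance S k \<le> N" unfolding N_def using exceedance_antimono[OF fin rk] .
  have N2: "N \<le> exceedance S k + (k - r)" unfolding N_def using exceedance_decrement[OF fin rk] .
  have "real k * L < real (j + 1) * n" "real j * n < real (r + 1) * L"
    using kj rj by (metis of_nat_less_iff of_nat_mult)+
  then have "(real k - real r) * L \<le> n + L" by (simp add: algebra_simps)
  then have "real k - real r \<le> n / L + 1"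
    using L by (simp add: field_simps)
  then have "(real k - real r) / n \<le> (n / L + 1) / n"
    by (rule divide_right_mono) simp
  also have "\<dots> = 1 / L + 1 / n"
    using n by (simp add: add_divide_distrib)
  also have "1 / real n \<le> 1 / real L" using L by (simp add: frac_le)
  finally have gap: "(real k - real r) / n \<le> 2 / L" by simp
  have up: "real N / n \<le> real (exceedance S k) / n + 2 / L"
  proof -
    have "real N \<le> real (exceedance S k) + (real k - real r)" using N2 rk by linarith
    then have "real N / n \<le> (real (exceedance S k) + (real k - real r)) / n"
      by (rule divide_right_mono) simp
    then show ?thesis using gap by (simp add: add_divide_distrib)
  qed
  have lo: "real (exceedance S k) / n \<le> real N / n"
    using N1 by (simp add: divide_right_mono)
  have "1 / real L \<le> 2 / real L" by (simp add: divide_right_mono)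
  then show "\<bar>real (exceedance S k) / n - step_profile L n a k\<bar> \<le> 2 / real L"
    using up lo s_up s_lo by linarith
qed

lemma step_profile_unit:
  assumes "a \<in> {..<L} \<rightarrow>\<^sub>E {..L}" "0 < L"
  shows "step_profile L n a \<in> unit_profiles"
proof -
  have "a (k * L div n) \<le> L" if "k < n" for k
  proof -
    have "k * L div n < L" using that assms(2)
      by (simp add: div_less_iff_less_mult mult.commute)
    then show ?thesis using assms(1) by (auto simp: PiE_iff)
  qed
  then show ?thesis using assms(2) by (auto simp: unit_profiles_def step_profile_def)
qed

definition max_energy :: "real \<Rightarrow> real \<Rightarrow> nat \<Rightarrow> real" where
  "max_energy \<rho> \<beta> n = (SUP h\<in>unit_profiles. energy \<rho> \<beta> n h)"

lemma potential_unit_bounds: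
  fixes \<beta> :: real
  assumes "h \<in> unit_profiles" "\<beta> \<ge> 0"
  shows "0 \<le> potential \<beta> n h i" and "i \<le> n \<Longrightarrow> potential \<beta> n h i \<le> 2 * \<beta>"
proof -
  have "0 \<le> (\<Sum>k<i. h k)" using assms by (intro sum_nonneg) (auto simp: unit_profiles_def)
  then show "0 \<le> potential \<beta> n h i" using assms by (simp add: potential_def)
  assume "i \<le> n"
  have "(\<Sum>k<i. h k) \<le> real (card {..<i}) * 1"
    by (rule sum_bounded_above) (use assms in \<open>auto simp: unit_profiles_def\<close>)
  then have "(\<Sum>k<i. h k) \<le> real n" using \<open>i \<le> n\<close> by simp
  then have "2 * \<beta> / n * (\<Sum>k<i. h k) \<le> 2 * \<beta> / n * n"
    using assms by (intro mult_left_mono) auto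
  also have "\<dots> \<le> 2 * \<beta>" using assms by simp
  finally show "potential \<beta> n h i \<le> 2 * \<beta>" by (simp add: potential_def)
qed

lemma energy_le:
  assumes "h \<in> unit_profiles" "\<rho> > 0" "\<beta> \<ge> 0" "n > 0"
  shows "energy \<rho> \<beta> n h \<le> ln (1 + \<rho> * exp (2 * \<beta>))"
proof -
  have "(\<Sum>i<n. ln (1 + \<rho> * exp (potential \<beta> n h i))) \<le> real (card {..<n}) * ln (1 + \<rho> * exp (2 * \<beta>))"
    by (rule sum_bounded_above) (use assms potential_unit_bounds in \<open>auto intro!: ln_one_plus_exp_mono\<close>)
  moreover have "0 \<le> \<beta> * (\<Sum>k<n. (h k)\<^sup>2)" using assms by (simp add: sum_nonneg)
  ultimately have "real n * energy \<rho> \<beta> n h \<le> real n * ln (1 + \<rho> * exp (2 * \<beta>))"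
    using assms by (simp add: real_energy_eq)
  then show ?thesis using assms by simp
qed

lemma energy_le_max_energy:
  assumes "h \<in> unit_profiles" "\<rho> > 0" "\<beta> \<ge> 0" "n > 0"
  shows "energy \<rho> \<beta> n h \<le> max_energy \<rho> \<beta> n"
  unfolding max_energy_def using assms energy_le
  by (intro cSUP_upper bdd_aboveI2[of _ _ "ln (1 + \<rho> * exp (2 * \<beta>))"]) auto

lemma max_energy_le:
  assumes "\<And>h. h \<in> unit_profiles \<Longrightarrow> energy \<rho> \<beta> n h \<le> B"
  shows "max_energy \<rho> \<beta> n \<le> B"
proof -
  have "(\<lambda>_. 0) \<in> unit_profiles" by (simp add: unit_profiles_def)
  then show ?thesis unfolding max_energy_def using assms by (intro cSUP_least) auto
qed

lemma partition_function_pos: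
  assumes "\<rho> > 0"
  shows "partition_function \<rho> c n > 0"
  unfolding partition_function_def using assms by (intro sum_pos) auto

text \<open>
  Every \<open>S\<close> is within \<open>2 / L\<close> of one of at most \<open>(L + 1) ^ L\<close> step profiles, and for that profile
  the tangent terms lose at most \<open>4 * \<beta> * n / L\<^sup>2\<close>. Summing over all step profiles bounds the
  partition function.
\<close>

lemma partition_function_le:
  fixes \<rho> \<beta> :: real
  assumes "\<rho> > 0" "\<beta> \<ge> 0" "0 < L" "L \<le> n"
  shows "partition_function \<rho> (\<beta> / (real n)\<^sup>2) n
     \<le> real ((L + 1) ^ L) * exp (real n * (4 * \<beta> / (real L)\<^sup>2 + max_energy \<rho> \<beta> n))"
proof -
  define A where "A = {..<L} \<rightarrow>\<^sub>E {..L}"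
  have n: "n > 0" using assms by simp
  have finA: "finite A" unfolding A_def by (intro finite_PiE) auto
  have cardA: "card A = (L + 1) ^ L" unfolding A_def by (subst card_PiE) auto
  define w where "w = (\<lambda>S. \<beta> / (real n)\<^sup>2 * (\<Sum>k<n. (real (exceedance S k))\<^sup>2))"
  define d where "d = (\<lambda>S a. \<beta> * (\<Sum>k<n. (real (exceedance S k) / n - step_profile L n a k)\<^sup>2))"
  have "partition_function \<rho> (\<beta> / (real n)\<^sup>2) n
      \<le> (\<Sum>S\<in>Pow {..<n}. \<Sum>a\<in>A. exp (real n * (4 * \<beta> / (real L)\<^sup>2)) * (\<rho> ^ card S * exp (w S - d S a)))"
    unfolding partition_function_def
  proof (rule sum_mono)
    fix S assume "S \<in> Pow {..<n}"
    then have S: "S \<subseteq> {..<n}" by simp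
    obtain a where a: "a \<in> A"
      and close: "\<And>k. k < n \<Longrightarrow> \<bar>real (exceedance S k) / n - step_profile L n a k\<bar> \<le> 2 / real L"
      using step_profile_approximates[OF S assms(3,4)] unfolding A_def by metis
    have "(\<Sum>k<n. (real (exceedance S k) / n - step_profile L n a k)\<^sup>2) \<le> real (card {..<n}) * (2 / real L)\<^sup>2"
    proof (rule sum_bounded_above)
      fix k assume "k \<in> {..<n}"
      then show "(real (exceedance S k) / n - step_profile L n a k)\<^sup>2 \<le> (2 / real L)\<^sup>2"
        using close[of k] by (metis abs_le_square_iff abs_of_nonneg divide_nonneg_nonneg lessThan_iff of_nat_0_le_iff zero_le_numeral)
    qed
    then have "d S a \<le> \<beta> * (real n * (2 / real L)\<^sup>2)"
      unfolding d_def using assms by (intro mult_left_mono) auto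
    then have d: "d S a \<le> real n * (4 * \<beta> / (real L)\<^sup>2)"
      by (simp add: power_divide mult_ac)
    have "0 \<le> \<beta> / (real n)\<^sup>2 * (\<Sum>i\<in>S. real i)"
      using assms by (simp add: sum_nonneg)
    then have "\<beta> / (real n)\<^sup>2 * ((\<Sum>k<n. (real (exceedance S k))\<^sup>2) - (\<Sum>i\<in>S. real i))
        \<le> real n * (4 * \<beta> / (real L)\<^sup>2) + (w S - d S a)"
      using d by (simp add: w_def right_diff_distrib)
    then have "\<rho> ^ card S * exp (\<beta> / (real n)\<^sup>2 * ((\<Sum>k<n. (real (exceedance S k))\<^sup>2) - (\<Sum>i\<in>S. real i)))
        \<le> exp (real n * (4 * \<beta> / (real L)\<^sup>2)) * (\<rho> ^ card S * exp (w S - d S a))"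
      using assms(1) by (simp add: mult.left_commute[of "exp (real n * _)"] exp_add[symmetric])
    also have "\<dots> \<le> (\<Sum>a\<in>A. exp (real n * (4 * \<beta> / (real L)\<^sup>2)) * (\<rho> ^ card S * exp (w S - d S a)))"
      by (rule member_le_sum[OF a _ finA]) (use assms in auto)
    finally show "\<rho> ^ card S * exp (\<beta> / (real n)\<^sup>2 * ((\<Sum>k<n. (real (exceedance S k))\<^sup>2) - (\<Sum>i\<in>S. real i)))
        \<le> (\<Sum>a\<in>A. exp (real n * (4 * \<beta> / (real L)\<^sup>2)) * (\<rho> ^ card S * exp (w S - d S a)))" .
  qed
  also have "\<dots> = (\<Sum>a\<in>A. exp (real n * (4 * \<beta> / (real L)\<^sup>2)) * exp (real n * energy \<rho> \<beta> n (step_profile L n a)))"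
    unfolding exp_energy_eq[OF assms(1) n] sum_distrib_left w_def d_def by (rule sum.swap)
  also have "\<dots> \<le> real (card A) * (exp (real n * (4 * \<beta> / (real L)\<^sup>2)) * exp (real n * max_energy \<rho> \<beta> n))"
  proof (rule sum_bounded_above)
    fix a assume "a \<in> A"
    then have "energy \<rho> \<beta> n (step_profile L n a) \<le> max_energy \<rho> \<beta> n"
      using assms n by (intro energy_le_max_energy step_profile_unit) (auto simp: A_def)
    then show "exp (real n * (4 * \<beta> / (real L)\<^sup>2)) * exp (real n * energy \<rho> \<beta> n (step_profile L n a))
      \<le> exp (real n * (4 * \<beta> / (real L)\<^sup>2)) * exp (real n * max_energy \<rho> \<beta> n)"
      by (simp add: mult_left_mono)
  qed
  also have "\<dots> = real ((L + 1) ^ L) * exp (real n * (4 * \<beta> / (real L)\<^sup>2 + max_energy \<rho> \<beta> n))"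
    by (simp add: cardA exp_add[symmetric] distrib_left)
  finally show ?thesis .
qed

section \<open>Existence of the limit\<close>

lemma sum_blocks_ge:
  fixes f :: "nat \<Rightarrow> real"
  assumes "\<And>K. j * m \<le> K \<Longrightarrow> K < j * m + m \<Longrightarrow> c \<le> f K"
  shows "real m * c \<le> sum f {j * m..<j * m + m}"
  using sum_bounded_below[of "{j * m..<j * m + m}" c f] assms by simp

lemma potential_mono_index:
  fixes \<beta> :: real
  assumes "h \<in> unit_profiles" "\<beta> \<ge> 0" "i \<le> j"
  shows "potential \<beta> n h i \<le> potential \<beta> n h j"
  unfolding potential_def using assms
  by (intro mult_left_mono sum_mono2) (auto simp: unit_profiles_def)

lemma potential_increment:
  fixes \<beta> :: real
  assumes "h \<in> unit_profiles" "\<beta> \<ge> 0" "i \<le> j"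
  shows "potential \<beta> n h j \<le> potential \<beta> n h i + 2 * \<beta> / n * (real j - real i)"
proof -
  have "(\<Sum>k<j. h k) = (\<Sum>k<i. h k) + (\<Sum>k=i..<j. h k)"
    using assms(3) by (simp add: sum.atLeastLessThan_concat[of 0 i j h] lessThan_atLeast0)
  moreover have "(\<Sum>k=i..<j. h k) \<le> real (card {i..<j}) * 1"
    by (rule sum_bounded_above) (use assms in \<open>auto simp: unit_profiles_def\<close>)
  ultimately have "(\<Sum>k<j. h k) \<le> (\<Sum>k<i. h k) + (real j - real i)"
    using assms(3) by (simp add: of_nat_diff)
  then have "2 * \<beta> / n * (\<Sum>k<j. h k) \<le> 2 * \<beta> / n * ((\<Sum>k<i. h k) + (real j - real i))"
    using assms by (intro mult_left_mono) auto
  then show ?thesis by (simp add: potential_def distrib_left)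
qed

text \<open>
  A profile is copied to a grid that is \<open>m\<close> times finer. The quadratic part and the potential at the
  block starts are unchanged, and the potential only increases within a block.
\<close>

lemma max_energy_le_refinement:
  fixes \<rho> \<beta> :: real
  assumes "\<rho> > 0" "\<beta> \<ge> 0" "n > 0" "m > 0"
  shows "max_energy \<rho> \<beta> n \<le> max_energy \<rho> \<beta> (n * m)"
proof (rule max_energy_le)
  fix h assume h: "h \<in> unit_profiles"
  define g where "g = (\<lambda>K. h (K div m))"
  have g: "g \<in> unit_profiles" using h by (auto simp: g_def unit_profiles_def)
  have block: "K div m = j" if "j * m \<le> K" "K < j * m + m" for j K
    using that assms(4) by (intro div_nat_eqI) (auto simp: mult.commute)
  have blocks: "(\<Sum>K<i * m. F (g K)) = real m * (\<Sum>j<i. F (h j))" for i and F :: "real \<Rightarrow> real"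
  proof -
    have "(\<Sum>K<i * m. F (g K)) = (\<Sum>j<i. sum (\<lambda>K. F (g K)) {j * m..<j * m + m})"
      by (rule sum.nat_group[symmetric])
    also have "\<dots> = (\<Sum>j<i. sum (\<lambda>K. F (h j)) {j * m..<j * m + m})"
      by (intro sum.cong refl) (auto simp: g_def block)
    finally show ?thesis by (simp add: sum_distrib_left)
  qed
  have pot: "potential \<beta> (n * m) g (j * m) = potential \<beta> n h j" for j
    using blocks[of "\<lambda>x. x" j] assms by (simp add: potential_def)
  have "real m * (\<Sum>j<n. ln (1 + \<rho> * exp (potential \<beta> n h j)))
      \<le> (\<Sum>j<n. sum (\<lambda>K. ln (1 + \<rho> * exp (potential \<beta> (n * m) g K))) {j * m..<j * m + m})"
    unfolding sum_distrib_left
  proof (intro sum_mono sum_blocks_ge)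
    fix j K assume "j * m \<le> K"
    then show "ln (1 + \<rho> * exp (potential \<beta> n h j)) \<le> ln (1 + \<rho> * exp (potential \<beta> (n * m) g K))"
      using potential_mono_index[OF g assms(2), of "j * m" K "n * m"] assms
      by (intro ln_one_plus_exp_mono) (auto simp: pot)
  qed
  also have "\<dots> = (\<Sum>K<n * m. ln (1 + \<rho> * exp (potential \<beta> (n * m) g K)))"
    by (rule sum.nat_group)
  finally have "real m * (real n * energy \<rho> \<beta> n h) \<le> real (n * m) * energy \<rho> \<beta> (n * m) g"
    using assms real_energy_eq[of \<rho> n \<beta> h] real_energy_eq[of \<rho> "n * m" \<beta> g]
      blocks[of "\<lambda>x. x\<^sup>2" n]
    by (simp add: right_diff_distrib mult.left_commute)
  then have "energy \<rho> \<beta> n h \<le> energy \<rho> \<beta> (n * m) g"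
    using assms by (simp add: mult.assoc[symmetric] mult.commute[of "real m"])
  also have "\<dots> \<le> max_energy \<rho> \<beta> (n * m)"
    using assms g by (intro energy_le_max_energy) auto
  finally show "energy \<rho> \<beta> n h \<le> max_energy \<rho> \<beta> (n * m)" .
qed

text \<open>
  Conversely, a profile on the finer grid is averaged over blocks. This keeps the potential at the
  block starts, which differs by at most \<open>2 * \<beta> / n\<close> from that inside the block, and by the
  Cauchy-Schwarz inequality it does not increase the quadratic part.
\<close>

lemma max_energy_refinement_le:
  fixes \<rho> \<beta> :: real
  assumes "\<rho> > 0" "\<beta> \<ge> 0" "n > 0" "m > 0"
  shows "max_energy \<rho> \<beta> (n * m) \<le> max_energy \<rho> \<beta> n + 2 * \<beta> / n"
proof (rule max_energy_le)
  fix g assume g: "g \<in> unit_profiles"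
  define h where "h = (\<lambda>j. sum g {j * m..<j * m + m} / m)"
  have h: "h \<in> unit_profiles"
  proof -
    have "0 \<le> sum g {j * m..<j * m + m}" for j
      using g by (intro sum_nonneg) (auto simp: unit_profiles_def)
    moreover have "sum g {j * m..<j * m + m} \<le> real (card {j * m..<j * m + m}) * 1" for j
      by (rule sum_bounded_above) (use g in \<open>auto simp: unit_profiles_def\<close>)
    ultimately show ?thesis using assms by (auto simp: h_def unit_profiles_def)
  qed
  have pot: "potential \<beta> (n * m) g (j * m) = potential \<beta> n h j" for j
  proof -
    have "(\<Sum>i<j. h i) = (\<Sum>K<j * m. g K) / m"
      unfolding h_def sum_divide_distrib[symmetric] sum.nat_group ..
    then show ?thesis using assms by (simp add: potential_def)
  qed
  have "(\<Sum>K<n * m. ln (1 + \<rho> * exp (potential \<beta> (n * m) g K)))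
      = (\<Sum>j<n. sum (\<lambda>K. ln (1 + \<rho> * exp (potential \<beta> (n * m) g K))) {j * m..<j * m + m})"
    by (rule sum.nat_group[symmetric])
  also have "\<dots> \<le> (\<Sum>j<n. real m * (ln (1 + \<rho> * exp (potential \<beta> n h j)) + 2 * \<beta> / n))"
  proof (rule sum_mono)
    fix j
    have "sum (\<lambda>K. ln (1 + \<rho> * exp (potential \<beta> (n * m) g K))) {j * m..<j * m + m}
       \<le> real (card {j * m..<j * m + m}) * (ln (1 + \<rho> * exp (potential \<beta> n h j)) + 2 * \<beta> / n)"
    proof (rule sum_bounded_above)
      fix K assume K: "K \<in> {j * m..<j * m + m}"
      have "2 * \<beta> / (n * m) * (real K - real (j * m)) \<le> 2 * \<beta> / (n * m) * m"
      proof (rule mult_left_mono)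
        have "real K \<le> real (j * m + m)" using K by (simp only: of_nat_le_iff) simp
        then show "real K - real (j * m) \<le> real m" by simp
      qed (use assms in simp)
      also have "\<dots> = 2 * \<beta> / n" using assms by simp
      finally have "potential \<beta> (n * m) g K \<le> potential \<beta> n h j + 2 * \<beta> / n"
        using potential_increment[OF g assms(2), of "j * m" K "n * m"] K by (simp add: pot)
      then show "ln (1 + \<rho> * exp (potential \<beta> (n * m) g K)) \<le> ln (1 + \<rho> * exp (potential \<beta> n h j)) + 2 * \<beta> / n"
        using assms by (intro ln_one_plus_exp_increment) auto
    qed
    then show "sum (\<lambda>K. ln (1 + \<rho> * exp (potential \<beta> (n * m) g K))) {j * m..<j * m + m}
       \<le> real m * (ln (1 + \<rho> * exp (potential \<beta> n h j)) + 2 * \<beta> / n)" by simp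
  qed
  also have "\<dots> = real m * (\<Sum>j<n. ln (1 + \<rho> * exp (potential \<beta> n h j))) + real m * (2 * \<beta>)"
    using assms by (simp add: sum_distrib_left[symmetric] sum.distrib distrib_left)
  finally have 1: "(\<Sum>K<n * m. ln (1 + \<rho> * exp (potential \<beta> (n * m) g K)))
      \<le> real m * (\<Sum>j<n. ln (1 + \<rho> * exp (potential \<beta> n h j))) + real m * (2 * \<beta>)" .
  have "real m * (\<Sum>j<n. (h j)\<^sup>2) \<le> (\<Sum>j<n. sum (\<lambda>K. (g K)\<^sup>2) {j * m..<j * m + m})"
    unfolding sum_distrib_left
  proof (rule sum_mono)
    fix j
    have "(sum g {j * m..<j * m + m})\<^sup>2 \<le> sum (\<lambda>K. (g K)\<^sup>2) {j * m..<j * m + m} * real m"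
      using sum_squared_le_sum_of_squares[of g "{j * m..<j * m + m}"] by simp
    then show "real m * (h j)\<^sup>2 \<le> sum (\<lambda>K. (g K)\<^sup>2) {j * m..<j * m + m}"
      using assms by (simp add: h_def power_divide power2_eq_square field_simps)
  qed
  also have "\<dots> = (\<Sum>K<n * m. (g K)\<^sup>2)" by (rule sum.nat_group)
  finally have "\<beta> * (real m * (\<Sum>j<n. (h j)\<^sup>2)) \<le> \<beta> * (\<Sum>K<n * m. (g K)\<^sup>2)"
    using assms by (intro mult_left_mono) auto
  with 1 have "real (n * m) * energy \<rho> \<beta> (n * m) g \<le> real m * (real n * energy \<rho> \<beta> n h) + real m * (2 * \<beta>)"
    using assms real_energy_eq[of \<rho> n \<beta> h] real_energy_eq[of \<rho> "n * m" \<beta> g]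
    by (simp add: right_diff_distrib mult.left_commute)
  also have "\<dots> = real (n * m) * (energy \<rho> \<beta> n h + 2 * \<beta> / n)"
    using assms by (simp add: distrib_left)
  finally have "energy \<rho> \<beta> (n * m) g \<le> energy \<rho> \<beta> n h + 2 * \<beta> / n"
    using assms by (simp del: of_nat_mult)
  also have "energy \<rho> \<beta> n h \<le> max_energy \<rho> \<beta> n"
    using assms h by (intro energy_le_max_energy) auto
  finally show "energy \<rho> \<beta> (n * m) g \<le> max_energy \<rho> \<beta> n + 2 * \<beta> / n" by simp
qed

text \<open>
  Comparing the grids of sizes \<open>n\<close> and \<open>m\<close> with their common refinement of size \<open>n * m\<close> shows the
  Cauchy property.
\<close>

lemma convergent_max_energy:
  fixes \<rho> \<beta> :: real
  assumes "\<rho> > 0" "\<beta> \<ge> 0"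
  shows "convergent (max_energy \<rho> \<beta>)"
proof (rule real_Cauchy_convergent, rule CauchyI')
  have step: "max_energy \<rho> \<beta> n - max_energy \<rho> \<beta> m \<le> 2 * \<beta> / m" if "n > 0" "m > 0" for n m
    using max_energy_le_refinement[OF assms that] max_energy_refinement_le[OF assms that(2,1)]
    by (simp add: mult.commute)
  fix e :: real assume "e > 0"
  obtain M :: nat where M: "2 * \<beta> / e < real M" using reals_Archimedean2 by blast
  have "\<bar>max_energy \<rho> \<beta> m - max_energy \<rho> \<beta> n\<bar> < e" if "m \<ge> Suc M" "n \<ge> Suc M" for m n
  proof -
    have "2 * \<beta> / k < e" if "k \<ge> Suc M" for k :: nat
    proof -
      have "2 * \<beta> / e < real k" using M that by linarith
      then show ?thesis using \<open>e > 0\<close> that by (simp add: field_simps)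
    qed
    from this[OF that(1)] this[OF that(2)] show ?thesis
      using step[of m n] step[of n m] that by force
  qed
  then show "\<exists>M. \<forall>m\<ge>M. \<forall>n>m. dist (max_energy \<rho> \<beta> m) (max_energy \<rho> \<beta> n) < e"
    unfolding dist_real_def by (metis less_imp_le order_trans)
qed

text \<open>
  The number \<open>L\<close> of blocks is fixed first, to make the linearisation error \<open>4 * \<beta> / L\<^sup>2\<close> small; for
  this \<open>L\<close> the entropy \<open>L * ln (L + 1) / n\<close> of the step profiles vanishes as \<open>n\<close> grows.
\<close>

lemma ln_partition_function_minus_max_energy:
  fixes \<rho> \<beta> :: real
  assumes "\<rho> > 0" "\<beta> \<ge> 0"
  shows "(\<lambda>n. ln (partition_function \<rho> (\<beta> / (real n)\<^sup>2) n) / n - max_energy \<rho> \<beta> n) \<longlonglongrightarrow> 0"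
proof (rule LIMSEQ_I)
  fix e :: real assume "e > 0"
  define Z where "Z = (\<lambda>n. partition_function \<rho> (\<beta> / (real n)\<^sup>2) n)"
  have Zpos: "Z n > 0" for n unfolding Z_def by (rule partition_function_pos[OF assms(1)])
  have lower: "max_energy \<rho> \<beta> n - \<beta> / n \<le> ln (Z n) / n" if "n > 0" for n
  proof -
    have "max_energy \<rho> \<beta> n \<le> ln (Z n) / n + \<beta> / n"
    proof (rule max_energy_le)
      fix h
      have "exp (real n * energy \<rho> \<beta> n h - \<beta>) \<le> Z n"
        unfolding Z_def by (rule partition_function_ge[OF assms that])
      then have "real n * energy \<rho> \<beta> n h - \<beta> \<le> ln (Z n)"
        using Zpos by (simp add: ln_ge_iff)
      then show "energy \<rho> \<beta> n h \<le> ln (Z n) / n + \<beta> / n"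
        using that by (simp add: field_simps)
    qed
    then show ?thesis by simp
  qed
  have upper: "ln (Z n) / n \<le> real L * ln (L + 1) / n + 4 * \<beta> / (real L)\<^sup>2 + max_energy \<rho> \<beta> n"
    if "0 < L" "L \<le> n" for n L :: nat
  proof -
    have "ln (Z n) \<le> ln (real ((L + 1) ^ L) * exp (real n * (4 * \<beta> / (real L)\<^sup>2 + max_energy \<rho> \<beta> n)))"
      using partition_function_le[OF assms that] Zpos unfolding Z_def by (intro ln_mono) auto
    also have "\<dots> = real L * ln (L + 1) + real n * (4 * \<beta> / (real L)\<^sup>2 + max_energy \<rho> \<beta> n)"
      by (simp add: ln_mult ln_realpow add_pos_pos)
    finally show ?thesis using that by (simp add: field_simps)
  qed
  have "(\<lambda>L. 4 * \<beta> / (real L)\<^sup>2) \<longlonglongrightarrow> 0" by real_asymp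
  from LIMSEQ_D[OF this, of "e / 2"] \<open>e > 0\<close> obtain L0 where L0: "\<And>L. L \<ge> L0 \<Longrightarrow> \<bar>4 * \<beta> / (real L)\<^sup>2\<bar> < e / 2"
    by auto
  define L where "L = Suc L0"
  have L: "0 < L" "L0 \<le> L" by (simp_all add: L_def)
  have L2: "4 * \<beta> / (real L)\<^sup>2 < e / 2"
    using L0[OF L(2)] abs_ge_self[of "4 * \<beta> / (real L)\<^sup>2"] by linarith
  have "(\<lambda>n. real L * ln (L + 1) / real n) \<longlonglongrightarrow> 0" by real_asymp
  from LIMSEQ_D[OF this, of "e / 2"] \<open>e > 0\<close> obtain N1
    where N1: "\<And>n. n \<ge> N1 \<Longrightarrow> \<bar>real L * ln (L + 1) / real n\<bar> < e / 2" by auto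
  have "(\<lambda>n. \<beta> / real n) \<longlonglongrightarrow> 0" by real_asymp
  from LIMSEQ_D[OF this \<open>e > 0\<close>] obtain N2
    where N2: "\<And>n. n \<ge> N2 \<Longrightarrow> \<bar>\<beta> / real n\<bar> < e" by auto
  show "\<exists>no. \<forall>n\<ge>no. norm (ln (partition_function \<rho> (\<beta> / (real n)\<^sup>2) n) / real n - max_energy \<rho> \<beta> n - 0) < e"
  proof (intro exI allI impI)
    fix n assume "n \<ge> L + N1 + N2"
    then have n: "n \<ge> L" "n \<ge> N1" "n \<ge> N2" "n > 0" using L(1) by auto
    show "norm (ln (partition_function \<rho> (\<beta> / (real n)\<^sup>2) n) / real n - max_energy \<rho> \<beta> n - 0) < e"
      using lower[OF n(4)] upper[OF L(1) n(1)] N1[OF n(2)] N2[OF n(3)] L2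
      unfolding Z_def real_norm_def by linarith
  qed
qed

section \<open>The mean-field map is a contraction at high density\<close>

text \<open>
  The profiles of configurations in which each site is occupied with probability at least \<open>4 / 5\<close>:
  beyond \<open>k\<close> there are \<open>n - 1 - k\<close> sites. For \<open>\<rho> \<ge> 4\<close> the vacancy weight of a site is at most
  \<open>1 / 4\<close>, whence the probability \<open>1 / (1 + 1 / 4)\<close>.
\<close>

definition filled_profiles :: "nat \<Rightarrow> (nat \<Rightarrow> real) set" where
  "filled_profiles n = {h \<in> unit_profiles. \<forall>k<n. 4 / 5 * (real n - 1 - real k) / n \<le> h k}"

lemma mean_field_map_filled:
  fixes \<rho> \<beta> :: real
  assumes "h \<in> unit_profiles" "\<rho> \<ge> 4" "\<beta> \<ge> 0"
  shows "mean_field_map \<rho> \<beta> n h \<in> filled_profiles n"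
proof (cases "n = 0")
  case True
  then show ?thesis by (simp add: filled_profiles_def unit_profiles_def mean_field_map_def)
next
  case False
  have p: "4 / 5 \<le> occupation \<rho> \<beta> n h i" for i
  proof -
    have "exp (- potential \<beta> n h i) / \<rho> \<le> 1 / 4"
      using potential_unit_bounds(1)[OF assms(1,3), of n i] assms(2) by (intro frac_le) auto
    moreover have "0 \<le> exp (- potential \<beta> n h i) / \<rho>" using assms(2) by simp
    ultimately show ?thesis unfolding occupation_def by (simp add: field_simps)
  qed
  have "\<rho> > 0" using assms by simp
  note bounds = occupation_bounds[OF this]
  have nn: "0 \<le> (\<Sum>i=Suc k..<n. occupation \<rho> \<beta> n h i)" for k
    by (intro sum_nonneg bounds)
  have le: "(\<Sum>i=Suc k..<n. occupation \<rho> \<beta> n h i) \<le> real n" for k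
  proof -
    have "(\<Sum>i=Suc k..<n. occupation \<rho> \<beta> n h i) \<le> real (card {Suc k..<n}) * 1"
      by (intro sum_bounded_above bounds)
    then show ?thesis by simp
  qed
  have ge: "4 / 5 * (real n - 1 - real k) \<le> (\<Sum>i=Suc k..<n. occupation \<rho> \<beta> n h i)" if "k < n" for k
  proof -
    have "real (card {Suc k..<n}) * (4 / 5) \<le> (\<Sum>i=Suc k..<n. occupation \<rho> \<beta> n h i)"
      by (intro sum_bounded_below p)
    then show ?thesis using that by (simp add: of_nat_diff)
  qed
  show ?thesis
    using False nn le ge
    by (auto simp: filled_profiles_def unit_profiles_def mean_field_map_def divide_right_mono
        divide_le_eq)
qed

text \<open>
  The lower bound is an arithmetic sum, \<open>\<Sum>k<i. n - 1 - k\<close>, which is at least \<open>i * n / 2\<close> for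
  \<open>i < n\<close>.
\<close>

lemma filled_potential_ge:
  fixes \<beta> :: real
  assumes "h \<in> filled_profiles n" "\<beta> \<ge> 0" "i < n"
  shows "4 / 5 * (\<beta> * i / n) \<le> potential \<beta> n h i"
proof -
  have sum_id: "(\<Sum>k<i. real k) = real i * (real i - 1) / 2"
    by (induction i) (auto simp: field_simps)
  have "real i * (real i + 1) \<le> real i * n" using assms by (intro mult_left_mono) auto
  then have "real i * n / 2 \<le> i * (real n - 1) - real i * (real i - 1) / 2"
    by (simp add: field_simps)
  then have "4 / 5 / n * (real i * n / 2) \<le> 4 / 5 / n * (i * (real n - 1) - real i * (real i - 1) / 2)"
    by (intro mult_left_mono) auto
  moreover have "4 / 5 / n * (real i * n / 2) = 2 / 5 * real i"
    using assms by simp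
  ultimately have "2 / 5 * real i \<le> 4 / 5 / n * (i * (real n - 1) - real i * (real i - 1) / 2)"
    by linarith
  also have "i * (real n - 1) - real i * (real i - 1) / 2 = (\<Sum>k<i. (real n - 1) - real k)"
    by (simp add: sum_subtractf[of "\<lambda>_. real n - 1"] sum_id del: sum_subtractf)
  also have "4 / 5 / n * \<dots> = (\<Sum>k<i. 4 / 5 * (real n - 1 - real k) / n)"
    unfolding sum_distrib_left by (rule sum.cong) auto
  also have "\<dots> \<le> (\<Sum>k<i. h k)"
    using assms by (intro sum_mono) (auto simp: filled_profiles_def)
  finally have "2 / 5 * real i \<le> (\<Sum>k<i. h k)" .
  then have "2 * \<beta> / n * (2 / 5 * real i) \<le> 2 * \<beta> / n * (\<Sum>k<i. h k)"
    using assms by (intro mult_left_mono) auto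
  then show ?thesis by (simp add: potential_def mult_ac)
qed

lemma potential_diff_le:
  fixes \<beta> :: real and g h :: "nat \<Rightarrow> real"
  assumes "\<beta> \<ge> 0" "\<And>k. \<bar>g k - h k\<bar> \<le> D"
  shows "\<bar>potential \<beta> n g i - potential \<beta> n h i\<bar> \<le> 2 * (\<beta> * i / n) * D"
proof -
  have "\<bar>\<Sum>k<i. g k - h k\<bar> \<le> (\<Sum>k<i. \<bar>g k - h k\<bar>)" by (rule sum_abs)
  also have "\<dots> \<le> real (card {..<i}) * D" by (rule sum_bounded_above) (rule assms)
  finally have "2 * \<beta> / n * \<bar>\<Sum>k<i. g k - h k\<bar> \<le> 2 * \<beta> / n * (real i * D)"
    using assms(1) by (intro mult_left_mono) auto
  moreover have "\<bar>potential \<beta> n g i - potential \<beta> n h i\<bar> = 2 * \<beta> / n * \<bar>\<Sum>k<i. g k - h k\<bar>"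
  proof -
    have "potential \<beta> n g i - potential \<beta> n h i = 2 * \<beta> / n * (\<Sum>k<i. g k - h k)"
      by (simp add: potential_def sum_subtractf algebra_simps)
    then show ?thesis using assms(1) by (simp only: abs_mult) simp
  qed
  ultimately show ?thesis by (simp add: mult_ac)
qed

lemma logistic_diff_le:
  fixes v w \<rho> :: real
  assumes "\<rho> > 0" "y \<le> v" "y \<le> w"
  shows "\<bar>1 / (1 + exp (- v) / \<rho>) - 1 / (1 + exp (- w) / \<rho>)\<bar> \<le> exp (- y) * \<bar>v - w\<bar> / \<rho>"
proof -
  have exp_diff: "exp (- s) - exp (- t) \<le> exp (- y) * \<bar>s - t\<bar>" if "y \<le> s" for s t :: real
  proof -
    have "exp (- s) - exp (- t) = exp (- s) * (1 - exp (s - t))"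
      by (simp add: right_diff_distrib flip: exp_add)
    also have "\<dots> \<le> exp (- s) * \<bar>s - t\<bar>"
    proof (rule mult_left_mono)
      show "1 - exp (s - t) \<le> \<bar>s - t\<bar>" using exp_ge_add_one_self[of "s - t"] by linarith
    qed simp
    also have "\<dots> \<le> exp (- y) * \<bar>s - t\<bar>"
      using that by (intro mult_right_mono) auto
    finally show ?thesis .
  qed
  define a b where "a = exp (- v) / \<rho>" and "b = exp (- w) / \<rho>"
  have ab: "0 < a" "0 < b" using assms by (auto simp: a_def b_def)
  have "1 / (1 + a) - 1 / (1 + b) = (b - a) / ((1 + a) * (1 + b))"
    using ab by (simp add: field_simps)
  then have "\<bar>1 / (1 + a) - 1 / (1 + b)\<bar> = \<bar>b - a\<bar> / ((1 + a) * (1 + b))"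
    using ab by (simp add: abs_mult)
  also have "\<dots> \<le> \<bar>b - a\<bar> / 1"
  proof (rule divide_left_mono)
    show "1 \<le> (1 + a) * (1 + b)" using ab by (simp add: algebra_simps)
    show "0 < (1 + a) * (1 + b) * 1" using ab by (simp add: add_pos_pos)
  qed simp
  also have "\<dots> = \<bar>exp (- w) - exp (- v)\<bar> / \<rho>"
    using assms by (simp add: a_def b_def diff_divide_distrib[symmetric])
  also have "\<dots> \<le> exp (- y) * \<bar>v - w\<bar> / \<rho>"
    using exp_diff[OF assms(2), of w] exp_diff[OF assms(3), of v] assms(1)
    by (intro divide_right_mono) (auto simp: abs_minus_commute abs_le_iff)
  finally show ?thesis by (simp add: a_def b_def)
qed

text \<open>
  At site \<open>i\<close> put \<open>x = \<beta> * i / n\<close>. Changing the profile by \<open>D\<close> changes the potential by at most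
  \<open>2 * x * D\<close>, while the slope of the occupation is at most \<open>exp (- (4 / 5) * x) / \<rho>\<close>, as the potential
  itself is at least \<open>(4 / 5) * x\<close>. The product is bounded uniformly in \<open>x\<close>, so the contraction factor
  depends neither on \<open>n\<close> nor on \<open>\<beta>\<close>.
\<close>

lemma mean_field_map_contraction:
  fixes \<rho> \<beta> :: real
  assumes "g \<in> filled_profiles n" "h \<in> filled_profiles n" "\<rho> \<ge> 4" "\<beta> \<ge> 0"
    and D: "\<And>k. \<bar>g k - h k\<bar> \<le> D"
  shows "\<bar>mean_field_map \<rho> \<beta> n g k - mean_field_map \<rho> \<beta> n h k\<bar> \<le> 5 / 8 * D"
proof -
  have "0 \<le> D" using D[of 0] by linarith
  have p: "\<bar>occupation \<rho> \<beta> n g i - occupation \<rho> \<beta> n h i\<bar> \<le> 5 / 8 * D" if "i < n" for i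
  proof -
    define x where "x = \<beta> * i / n"
    have "x \<ge> 0" using assms by (simp add: x_def)
    have "4 / 5 * x + 1 \<le> exp (4 / 5 * x)" by (metis add.commute exp_ge_add_one_self)
    then have "x \<le> 5 / 4 * exp (4 / 5 * x)" by linarith
    then have x: "exp (- (4 / 5 * x)) * x \<le> 5 / 4" by (simp add: exp_minus field_simps)
    have "\<bar>occupation \<rho> \<beta> n g i - occupation \<rho> \<beta> n h i\<bar>
        \<le> exp (- (4 / 5 * x)) * \<bar>potential \<beta> n g i - potential \<beta> n h i\<bar> / \<rho>"
      unfolding occupation_def x_def using assms that filled_potential_ge
      by (intro logistic_diff_le) auto
    also have "\<dots> \<le> exp (- (4 / 5 * x)) * (2 * x * D) / \<rho>"
      using potential_diff_le[where g = g and h = h and n = n and i = i, OF assms(4) D] assms(3)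
      by (intro divide_right_mono mult_left_mono) (auto simp: x_def)
    also have "\<dots> = (exp (- (4 / 5 * x)) * x) * (2 * D) / \<rho>" by simp
    also have "\<dots> \<le> 5 / 4 * (2 * D) / 4"
      using x assms(3) \<open>0 \<le> D\<close> \<open>0 \<le> x\<close> by (intro frac_le mult_right_mono mult_nonneg_nonneg) auto
    finally show ?thesis by simp
  qed
  have "\<bar>(\<Sum>i=Suc k..<n. occupation \<rho> \<beta> n g i - occupation \<rho> \<beta> n h i)\<bar>
      \<le> (\<Sum>i=Suc k..<n. \<bar>occupation \<rho> \<beta> n g i - occupation \<rho> \<beta> n h i\<bar>)" by (rule sum_abs)
  also have "\<dots> \<le> real (card {Suc k..<n}) * (5 / 8 * D)"
    by (rule sum_bounded_above) (use p in auto)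
  also have "\<dots> \<le> real n * (5 / 8 * D)"
    using \<open>0 \<le> D\<close> by (intro mult_right_mono) auto
  finally have "\<bar>\<Sum>i=Suc k..<n. occupation \<rho> \<beta> n g i - occupation \<rho> \<beta> n h i\<bar> / n \<le> real n * (5 / 8 * D) / n"
    by (rule divide_right_mono) simp
  also have "\<dots> \<le> 5 / 8 * D" using \<open>0 \<le> D\<close> by simp
  finally show ?thesis
    by (simp add: mean_field_map_def sum_subtractf diff_divide_distrib[symmetric])
qed

lemma energy_lipschitz:
  fixes \<rho> \<beta> :: real
  assumes "g \<in> unit_profiles" "h \<in> unit_profiles" "\<rho> > 0" "\<beta> \<ge> 0" "n > 0"
    and D: "\<And>k. \<bar>g k - h k\<bar> \<le> D"
  shows "energy \<rho> \<beta> n g \<le> energy \<rho> \<beta> n h + 4 * \<beta> * D"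
proof -
  have "0 \<le> D" using D[of 0] by linarith
  have "(\<Sum>i<n. ln (1 + \<rho> * exp (potential \<beta> n g i)))
      \<le> (\<Sum>i<n. ln (1 + \<rho> * exp (potential \<beta> n h i)) + 2 * \<beta> * D)"
  proof (intro sum_mono ln_one_plus_exp_increment)
    fix i assume "i \<in> {..<n}"
    then have "2 * (\<beta> * i / n) * D \<le> 2 * \<beta> * D"
      using assms \<open>0 \<le> D\<close> by (intro mult_right_mono mult_left_mono) (auto simp: divide_le_eq mult_left_mono)
    then show "potential \<beta> n g i \<le> potential \<beta> n h i + 2 * \<beta> * D"
      using potential_diff_le[where g = g and h = h and n = n and i = i, OF assms(4) D] by (auto simp: abs_le_iff)
  qed (use assms \<open>0 \<le> D\<close> in auto)
  also have "\<dots> = (\<Sum>i<n. ln (1 + \<rho> * exp (potential \<beta> n h i))) + real n * (2 * \<beta> * D)"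
    by (simp add: sum.distrib)
  finally have 1: "(\<Sum>i<n. ln (1 + \<rho> * exp (potential \<beta> n g i)))
      \<le> (\<Sum>i<n. ln (1 + \<rho> * exp (potential \<beta> n h i))) + real n * (2 * \<beta> * D)" .
  have "(\<Sum>k<n. (h k)\<^sup>2) \<le> (\<Sum>k<n. (g k)\<^sup>2 + 2 * D)"
  proof (rule sum_mono)
    fix k
    have "(h k)\<^sup>2 - (g k)\<^sup>2 = (h k - g k) * (h k + g k)"
      by (simp add: power2_eq_square algebra_simps)
    also have "\<dots> \<le> D * (h k + g k)"
      using D[of k] assms by (intro mult_right_mono) (auto simp: unit_profiles_def add_nonneg_nonneg abs_le_iff)
    also have "\<dots> \<le> D * 2"
    proof (rule mult_left_mono)
      have "h k \<le> 1" "g k \<le> 1" using assms(1,2) by (auto simp: unit_profiles_def)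
      then show "h k + g k \<le> 2" by linarith
    qed (rule \<open>0 \<le> D\<close>)
    finally show "(h k)\<^sup>2 \<le> (g k)\<^sup>2 + 2 * D" by simp
  qed
  then have "\<beta> * (\<Sum>k<n. (h k)\<^sup>2) \<le> \<beta> * ((\<Sum>k<n. (g k)\<^sup>2) + real n * (2 * D))"
    using assms by (intro mult_left_mono) (auto simp: sum.distrib)
  with 1 have "real n * energy \<rho> \<beta> n g \<le> real n * (energy \<rho> \<beta> n h + 4 * \<beta> * D)"
    using assms by (simp add: real_energy_eq distrib_left algebra_simps)
  then show ?thesis using assms by simp
qed

text \<open>
  The number of iterations grows with \<open>n\<close> so that the distance to the maximal energy vanishes in the
  limit; one extra step moves the starting profile \<open>0\<close> into the filled profiles.
\<close>

definition mean_field_energy ::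
  "'a::{real_normed_field,banach,ln} \<Rightarrow> 'a \<Rightarrow> nat \<Rightarrow> 'a" where
  "mean_field_energy \<rho> \<beta> n = energy \<rho> \<beta> n ((mean_field_map \<rho> \<beta> n ^^ Suc n) (\<lambda>_. 0))"

lemma mean_field_iterates_approach:
  fixes \<rho> \<beta> :: real
  assumes "g \<in> unit_profiles" "h \<in> unit_profiles" "\<rho> \<ge> 4" "\<beta> \<ge> 0"
  shows "(mean_field_map \<rho> \<beta> n ^^ Suc j) g \<in> filled_profiles n \<and>
    (mean_field_map \<rho> \<beta> n ^^ Suc j) h \<in> filled_profiles n \<and>
    (\<forall>k. \<bar>(mean_field_map \<rho> \<beta> n ^^ Suc j) g k - (mean_field_map \<rho> \<beta> n ^^ Suc j) h k\<bar> \<le> (5 / 8) ^ j)"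
proof (induction j)
  case 0
  have T: "mean_field_map \<rho> \<beta> n g \<in> filled_profiles n" "mean_field_map \<rho> \<beta> n h \<in> filled_profiles n"
    using assms by (auto intro: mean_field_map_filled)
  have "\<bar>mean_field_map \<rho> \<beta> n g k - mean_field_map \<rho> \<beta> n h k\<bar> \<le> 1" for k
  proof -
    have "0 \<le> mean_field_map \<rho> \<beta> n g k" "mean_field_map \<rho> \<beta> n g k \<le> 1"
         "0 \<le> mean_field_map \<rho> \<beta> n h k" "mean_field_map \<rho> \<beta> n h k \<le> 1"
      using T by (auto simp: filled_profiles_def unit_profiles_def)
    then show ?thesis by linarith
  qed
  then show ?case using T by simp
next
  case (Suc j)
  define g' h' where "g' = (mean_field_map \<rho> \<beta> n ^^ Suc j) g" and "h' = (mean_field_map \<rho> \<beta> n ^^ Suc j) h"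
  have IH: "g' \<in> filled_profiles n" "h' \<in> filled_profiles n" "\<And>k. \<bar>g' k - h' k\<bar> \<le> (5 / 8) ^ j"
    using Suc by (auto simp: g'_def h'_def)
  have "g' \<in> unit_profiles" "h' \<in> unit_profiles" using IH by (auto simp: filled_profiles_def)
  then have "mean_field_map \<rho> \<beta> n g' \<in> filled_profiles n" "mean_field_map \<rho> \<beta> n h' \<in> filled_profiles n"
    using assms by (auto intro: mean_field_map_filled)
  moreover have "\<bar>mean_field_map \<rho> \<beta> n g' k - mean_field_map \<rho> \<beta> n h' k\<bar> \<le> 5 / 8 * (5 / 8) ^ j" for k
    using IH assms by (intro mean_field_map_contraction) auto
  moreover have "(mean_field_map \<rho> \<beta> n ^^ Suc (Suc j)) f = mean_field_map \<rho> \<beta> n ((mean_field_map \<rho> \<beta> n ^^ Suc j) f)" for f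
    by simp
  ultimately show ?case unfolding g'_def h'_def by (simp only: power_Suc) blast
qed

lemma energy_le_energy_iterate:
  fixes \<rho> \<beta> :: real
  assumes "\<rho> > 0" "\<beta> \<ge> 0"
  shows "energy \<rho> \<beta> n h \<le> energy \<rho> \<beta> n ((mean_field_map \<rho> \<beta> n ^^ j) h)"
proof (induction j)
  case (Suc j)
  also have "energy \<rho> \<beta> n ((mean_field_map \<rho> \<beta> n ^^ j) h) \<le> energy \<rho> \<beta> n (mean_field_map \<rho> \<beta> n ((mean_field_map \<rho> \<beta> n ^^ j) h))"
    by (rule energy_le_energy_mean_field_map[OF assms])
  finally show ?case by simp
qed simp

text \<open>
  Iterating the mean-field map from any profile \<open>h\<close> does not lower the energy, and the iterates from
  \<open>h\<close> and from \<open>0\<close> approach each other geometrically. So the energy of \<open>h\<close> exceeds that of the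
  iterate of \<open>0\<close> at most by a geometrically small amount.
\<close>

lemma max_energy_minus_mean_field_energy:
  fixes \<rho> \<beta> :: real
  assumes "\<rho> \<ge> 4" "\<beta> \<ge> 0"
  shows "(\<lambda>n. max_energy \<rho> \<beta> n - mean_field_energy \<rho> \<beta> n) \<longlonglongrightarrow> 0"
proof (rule tendsto_sandwich[of "\<lambda>_. 0" _ _ "\<lambda>n. 4 * \<beta> * (5 / 8) ^ n"])
  have z: "(\<lambda>_. 0) \<in> unit_profiles" by (simp add: unit_profiles_def)
  have pos: "\<rho> > 0" using assms by simp
  have "0 \<le> max_energy \<rho> \<beta> n - mean_field_energy \<rho> \<beta> n" if "n > 0" for n
  proof -
    have "(mean_field_map \<rho> \<beta> n ^^ Suc n) (\<lambda>_. 0) \<in> unit_profiles"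
      using mean_field_iterates_approach[OF z z assms, of n n] by (auto simp: filled_profiles_def)
    then show ?thesis
      unfolding mean_field_energy_def using energy_le_max_energy pos assms that by simp
  qed
  then show "\<forall>\<^sub>F n in sequentially. 0 \<le> max_energy \<rho> \<beta> n - mean_field_energy \<rho> \<beta> n"
    by (intro eventually_mono[OF eventually_gt_at_top[of 0]]) auto
  have "max_energy \<rho> \<beta> n \<le> mean_field_energy \<rho> \<beta> n + 4 * \<beta> * (5 / 8) ^ n" if "n > 0" for n
  proof (rule max_energy_le)
    fix h assume h: "h \<in> unit_profiles"
    have "energy \<rho> \<beta> n h \<le> energy \<rho> \<beta> n ((mean_field_map \<rho> \<beta> n ^^ Suc n) h)"
      by (rule energy_le_energy_iterate[OF pos assms(2)])
    also have "\<dots> \<le> mean_field_energy \<rho> \<beta> n + 4 * \<beta> * (5 / 8) ^ n"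
      unfolding mean_field_energy_def
      using mean_field_iterates_approach[OF h z assms, of n n] pos assms(2) that
      by (intro energy_lipschitz) (auto simp: filled_profiles_def)
    finally show "energy \<rho> \<beta> n h \<le> mean_field_energy \<rho> \<beta> n + 4 * \<beta> * (5 / 8) ^ n" .
  qed
  then show "\<forall>\<^sub>F n in sequentially. max_energy \<rho> \<beta> n - mean_field_energy \<rho> \<beta> n \<le> 4 * \<beta> * (5 / 8) ^ n"
    by (intro eventually_mono[OF eventually_gt_at_top[of 0]]) (auto simp: algebra_simps)
  show "(\<lambda>n. 4 * \<beta> * (5 / 8) ^ n) \<longlonglongrightarrow> 0"
    by (intro tendsto_mult_right_zero LIMSEQ_realpow_zero) auto
qed simp

lemma lyapunov_exponent_mean_field:
  assumes bm: "standard_brownian_motion M W" and adm: "admissible_scaling \<sigma> \<tau>" and "x0 > 0"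
    and "\<rho> \<ge> 4" "\<beta> > 0"
  shows "mean_field_energy \<rho> \<beta> \<longlonglongrightarrow> lyapunov_exponent M W \<sigma> \<tau> x0 (\<rho>, \<beta>)"
proof -
  have pos: "\<rho> > 0" and \<beta>: "\<beta> \<ge> 0" using assms by auto
  define Z where "Z = (\<lambda>n. partition_function \<rho> (\<beta> / (real n)\<^sup>2) n)"
  define e where "e = (\<lambda>n. ln (LINT \<omega>|M. growth_process W \<rho> (\<sigma> \<beta> n) (\<tau> \<beta> n) x0 n \<omega>) / real n)"
  have e: "e n = ln x0 / n + ln (Z n) / n" if "n \<ge> 1" for n
  proof -
    have t: "\<tau> \<beta> n > 0" "(1/2) * (\<sigma> \<beta> n)\<^sup>2 * \<tau> \<beta> n * (real n)\<^sup>2 = \<beta>"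
      using adm \<open>\<beta> > 0\<close> that by (auto simp: admissible_scaling_def)
    then have "(\<sigma> \<beta> n)\<^sup>2 * \<tau> \<beta> n / 2 = \<beta> / (real n)\<^sup>2"
      using that by (simp add: field_simps)
    then have "(LINT \<omega>|M. growth_process W \<rho> (\<sigma> \<beta> n) (\<tau> \<beta> n) x0 n \<omega>) = x0 * Z n"
      using expectation_growth_process[OF bm t(1)] by (simp add: Z_def)
    moreover have "Z n > 0" unfolding Z_def by (rule partition_function_pos[OF pos])
    ultimately show ?thesis
      using \<open>x0 > 0\<close> by (simp add: e_def ln_mult add_divide_distrib)
  qed
  obtain l where l: "max_energy \<rho> \<beta> \<longlonglongrightarrow> l"
    using convergent_max_energy[OF pos \<beta>] by (auto simp: convergent_def)
  have mf: "mean_field_energy \<rho> \<beta> \<longlonglongrightarrow> l"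
    using tendsto_diff[OF l max_energy_minus_mean_field_energy[OF assms(4) \<beta>]] by simp
  have "(\<lambda>n. ln x0 / real n) \<longlonglongrightarrow> 0" by real_asymp
  moreover have "(\<lambda>n. ln (Z n) / n) \<longlonglongrightarrow> l"
    using tendsto_add[OF ln_partition_function_minus_max_energy[OF pos \<beta>] l] by (simp add: Z_def)
  ultimately have "(\<lambda>n. ln x0 / n + ln (Z n) / n) \<longlonglongrightarrow> l"
    using tendsto_add by fastforce
  then have "e \<longlonglongrightarrow> l"
    by (rule Lim_transform_eventually) (auto simp: e eventually_sequentially intro!: exI[of _ 1])
  then have "lyapunov_exponent M W \<sigma> \<tau> x0 (\<rho>, \<beta>) = l"
    by (simp add: lyapunov_exponent_def e_def limI)
  then show ?thesis using mf by simp
qed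

section \<open>Limits of bounded holomorphic functions of two variables\<close>

lemma bounded_holomorphic_taylor:
  fixes f :: "complex \<Rightarrow> complex"
  assumes hol: "f holomorphic_on ball z R" and bound: "\<And>x. x \<in> ball z R \<Longrightarrow> norm (f x) \<le> B"
    and s: "0 < s" "s < R"
  shows "norm ((deriv ^^ i) f z / fact i) \<le> B / s ^ i"
    and "w \<in> ball z R \<Longrightarrow> (\<lambda>i. (deriv ^^ i) f z / fact i * (w - z) ^ i) sums f w"
proof -
  have "norm ((deriv ^^ i) f z) \<le> fact i * B / s ^ i"
  proof (rule Cauchy_inequality)
    show "f holomorphic_on ball z s" using hol by (rule holomorphic_on_subset) (use s in auto)
    show "continuous_on (cball z s) f"
      using holomorphic_on_imp_continuous_on[OF hol] by (rule continuous_on_subset) (use s in auto)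
    show "norm (f x) \<le> B" if "norm (z - x) = s" for x
      using that s by (intro bound) (auto simp: dist_norm)
  qed (use s in auto)
  then show "norm ((deriv ^^ i) f z / fact i) \<le> B / s ^ i"
    by (simp add: norm_divide field_simps)
  show "w \<in> ball z R \<Longrightarrow> (\<lambda>i. (deriv ^^ i) f z / fact i * (w - z) ^ i) sums f w"
    using holomorphic_power_series[OF hol] by simp
qed

text \<open>
  By induction on \<open>i\<close>: subtracting the first \<open>i\<close> Taylor terms from \<open>F (x0 + t) y\<close> and dividing by
  \<open>t ^ i\<close> gives functions that are holomorphic in \<open>y\<close> and, by the Cauchy estimates, converge to the
  coefficient uniformly in \<open>y\<close> as \<open>t\<close> tends to \<open>0\<close>.
\<close>

lemma taylor_coefficient_holomorphic:
  fixes F :: "complex \<Rightarrow> complex \<Rightarrow> complex"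
  assumes "open V"
    and hx: "\<And>y. y \<in> V \<Longrightarrow> (\<lambda>x. F x y) holomorphic_on ball x0 R"
    and hy: "\<And>x. x \<in> ball x0 R \<Longrightarrow> F x holomorphic_on V"
    and bound: "\<And>x y. x \<in> ball x0 R \<Longrightarrow> y \<in> V \<Longrightarrow> norm (F x y) \<le> B"
    and "0 < R"
  shows "(\<lambda>y. (deriv ^^ i) (\<lambda>x. F x y) x0 / fact i) holomorphic_on V"
proof (induction i rule: less_induct)
  case (less i)
  define a where "a = (\<lambda>i y. (deriv ^^ i) (\<lambda>x. F x y) x0 / fact i)"
  define s where "s = R / 2"
  have s: "0 < s" "s < R" using \<open>0 < R\<close> by (auto simp: s_def)
  define t where "t = (\<lambda>m::nat. s / (real m + 2))"
  have t: "0 < t m" "t m \<le> s / 2" for m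
    using s by (auto simp: t_def field_simps)
  have coeff: "norm (a j y) \<le> B / s ^ j" if "y \<in> V" for j y
    unfolding a_def by (rule bounded_holomorphic_taylor(1)[OF hx[OF that] _ s]) (use bound that in auto)
  have series: "(\<lambda>j. a j y * of_real (t m) ^ j) sums F (x0 + of_real (t m)) y" if "y \<in> V" for y m
    using bounded_holomorphic_taylor(2)[OF hx[OF that] bound s, of "x0 + of_real (t m)"] that t[of m] s
    unfolding a_def by (auto simp: dist_norm)
  define g where "g = (\<lambda>m y. (F (x0 + of_real (t m)) y - (\<Sum>j<i. a j y * of_real (t m) ^ j)) / of_real (t m) ^ i)"
  have g_hol: "g m holomorphic_on V" for m
  proof -
    have "x0 + of_real (t m) \<in> ball x0 R" using t[of m] s by (auto simp: dist_norm)
    then show ?thesis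
      unfolding g_def using less.IH t[of m]
      by (intro holomorphic_intros hy) (auto simp: a_def)
  qed
  have close: "norm (g m y - a i y) \<le> 2 * B / s ^ Suc i * t m" if "y \<in> V" for m y
  proof -
    have tail: "(\<lambda>j. a (j + i) y * of_real (t m) ^ (j + i)) sums
        (F (x0 + of_real (t m)) y - (\<Sum>j<i. a j y * of_real (t m) ^ j))"
      using sums_iff_shift[of "\<lambda>j. a j y * of_real (t m) ^ j" i] series[OF that, of m] by simp
    have "(\<lambda>j. a (j + i) y * of_real (t m) ^ (j + i) / of_real (t m) ^ i) sums g m y"
      unfolding g_def by (rule sums_divide[OF tail])
    then have "(\<lambda>j. a (j + i) y * of_real (t m) ^ j) sums g m y"
      using t[of m] by (simp add: power_add)
    then have "(\<lambda>j. a (Suc j + i) y * of_real (t m) ^ Suc j) sums (g m y - a i y)"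
      by (subst sums_Suc_iff) simp
    moreover have "(\<lambda>j. B / s ^ Suc i * t m * (1 / 2) ^ j) sums (B / s ^ Suc i * t m * 2)"
      using geometric_sums[of "1 / 2 :: real"] by (intro sums_mult) auto
    moreover have "norm (a (Suc j + i) y * of_real (t m) ^ Suc j) \<le> B / s ^ Suc i * t m * (1 / 2) ^ j" for j
    proof -
      have "0 \<le> B" using coeff[OF that, of 0] norm_ge_zero[of "a 0 y"] by (simp only: power_0 div_by_1)
      have "norm (a (Suc j + i) y * of_real (t m) ^ Suc j) \<le> B / s ^ (Suc j + i) * t m ^ Suc j"
        unfolding norm_mult norm_power using coeff[OF that, of "Suc j + i"] t[of m] s \<open>0 \<le> B\<close>
        by (intro mult_mono) auto
      also have "\<dots> = B / s ^ Suc i * t m * (t m / s) ^ j"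
        by (simp add: power_add power_divide mult_ac)
      also have "\<dots> \<le> B / s ^ Suc i * t m * (1 / 2) ^ j"
        using t[of m] s \<open>0 \<le> B\<close> by (intro mult_left_mono power_mono) (auto simp: field_simps)
      finally show ?thesis .
    qed
    ultimately have "norm (g m y - a i y) \<le> B / s ^ Suc i * t m * 2"
      by (rule norm_sums_le)
    then show ?thesis by (simp add: mult_ac)
  qed
  have lim0: "(\<lambda>m. 2 * B / s ^ Suc i * t m) \<longlonglongrightarrow> 0"
    unfolding t_def by (intro tendsto_mult_right_zero) real_asymp
  have "uniform_limit V g (a i) sequentially"
  proof (rule uniform_limitI)
    fix e :: real assume "e > 0"
    from order_tendstoD(2)[OF lim0 this]
    show "\<forall>\<^sub>F m in sequentially. \<forall>y\<in>V. dist (g m y) (a i y) < e"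
    proof (rule eventually_mono, intro ballI)
      fix m y assume "2 * B / s ^ Suc i * t m < e" "y \<in> V"
      then show "dist (g m y) (a i y) < e"
        using close[of y m] unfolding dist_norm by linarith
    qed
  qed
  then have "\<exists>d>0. cball y d \<subseteq> V \<and> uniform_limit (cball y d) g (a i) sequentially" if "y \<in> V" for y
    using open_contains_cball[of V] \<open>open V\<close> that uniform_limit_on_subset by metis
  then have "a i holomorphic_on V"
    by (rule holomorphic_uniform_sequence[OF \<open>open V\<close> g_hol])
  then show ?case by (simp add: a_def)
qed

text \<open>
  Expansion in \<open>x\<close> first: the coefficients are bounded holomorphic functions of \<open>y\<close>, which are
  expanded in turn.
\<close>

lemma bounded_double_taylor:
  fixes F :: "complex \<Rightarrow> complex \<Rightarrow> complex"
  assumes hx: "\<And>y. y \<in> ball y0 R \<Longrightarrow> (\<lambda>x. F x y) holomorphic_on ball x0 R"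
    and hy: "\<And>x. x \<in> ball x0 R \<Longrightarrow> F x holomorphic_on ball y0 R"
    and bound: "\<And>x y. x \<in> ball x0 R \<Longrightarrow> y \<in> ball y0 R \<Longrightarrow> norm (F x y) \<le> B"
    and s: "0 < s" "s < R"
  shows "\<exists>c. (\<forall>i j. norm (c i j) \<le> B / s ^ (i + j)) \<and>
      (\<forall>x\<in>ball x0 s. \<forall>y\<in>ball y0 s.
        (\<lambda>i. (\<Sum>j. c i j * (y - y0) ^ j) * (x - x0) ^ i) sums F x y) \<and>
      (\<forall>i. \<forall>y\<in>ball y0 s. norm (\<Sum>j. c i j * (y - y0) ^ j) \<le> B / s ^ i)"
proof -
  have "0 < R" using s by simp
  define a where "a = (\<lambda>i y. (deriv ^^ i) (\<lambda>x. F x y) x0 / fact i)"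
  define c where "c = (\<lambda>i j. (deriv ^^ j) (a i) y0 / fact j)"
  have a_hol: "a i holomorphic_on ball y0 R" for i
    unfolding a_def by (rule taylor_coefficient_holomorphic[OF open_ball hx hy bound \<open>0 < R\<close>])
  have a_bound: "norm (a i y) \<le> B / s ^ i" if "y \<in> ball y0 R" for i y
    unfolding a_def by (rule bounded_holomorphic_taylor(1)[OF hx[OF that] bound s]) (use that in auto)
  have c_bound: "norm (c i j) \<le> B / s ^ (i + j)" for i j
  proof -
    have "norm (c i j) \<le> B / s ^ i / s ^ j"
      unfolding c_def by (rule bounded_holomorphic_taylor(1)[OF a_hol a_bound s])
    then show ?thesis by (simp add: power_add)
  qed
  have a_eq: "a i y = (\<Sum>j. c i j * (y - y0) ^ j)" if "y \<in> ball y0 s" for i y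
    unfolding c_def
    using bounded_holomorphic_taylor(2)[OF a_hol a_bound s] that s by (auto simp: sums_iff)
  show ?thesis
  proof (intro exI[of _ c] conjI allI ballI)
    show "norm (c i j) \<le> B / s ^ (i + j)" for i j by (rule c_bound)
    fix y assume y: "y \<in> ball y0 s"
    then have yR: "y \<in> ball y0 R" using s by auto
    show "norm (\<Sum>j. c i j * (y - y0) ^ j) \<le> B / s ^ i" for i
      using a_bound[OF yR] a_eq[OF y] by simp
    fix x assume "x \<in> ball x0 s"
    then have "x \<in> ball x0 R" using s by auto
    then show "(\<lambda>i. (\<Sum>j. c i j * (y - y0) ^ j) * (x - x0) ^ i) sums F x y"
      unfolding a_eq[OF y, symmetric] a_def
      by (intro bounded_holomorphic_taylor(2)[OF hx[OF yR] bound s]) (use yR in auto)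
  qed
qed

lemma double_power_series_has_sum:
  fixes c :: "nat \<Rightarrow> nat \<Rightarrow> complex"
  assumes c: "\<And>i j. norm (c i j) \<le> B / s ^ (i + j)" and "0 < s"
    and u: "norm u \<le> s / 2" and v: "norm v \<le> s / 2"
  shows "((\<lambda>(i, j). c i j * u ^ i * v ^ j) has_sum (\<Sum>i. (\<Sum>j. c i j * v ^ j) * u ^ i)) UNIV"
proof -
  have B: "0 \<le> B" using order_trans[OF norm_ge_zero c[of 0 0]] by simp
  have half: "norm w ^ k \<le> (s / 2) ^ k" if "norm w \<le> s / 2" for w :: complex and k
    using that by (intro power_mono) auto
  have term_le: "norm (c i j * u ^ i * v ^ j) \<le> B * (1 / 2) ^ i * (1 / 2) ^ j" for i j
  proof -
    have "norm (c i j * u ^ i * v ^ j) \<le> B / s ^ (i + j) * (s / 2) ^ i * (s / 2) ^ j"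
      unfolding norm_mult norm_power using c half[OF u] half[OF v] B \<open>0 < s\<close>
      by (intro mult_mono) auto
    also have "\<dots> = B * (1 / 2) ^ i * (1 / 2) ^ j"
      using \<open>0 < s\<close> by (simp add: power_add power_divide)
    finally show ?thesis .
  qed
  have geo: "((\<lambda>k. r * (1 / 2) ^ k) has_sum (r * 2)) UNIV" if "0 \<le> r" for r :: real
    using that geometric_sums[of "1 / 2 :: real"]
    by (intro norm_summable_imp_has_sum sums_mult summable_mult) (auto simp: abs_mult intro!: summable_mult)
  have "(\<lambda>(i, j). B * (1 / 2) ^ i * (1 / 2) ^ j) summable_on UNIV \<times> (UNIV :: nat set)"
  proof (rule summable_on_SigmaI)
    show "((\<lambda>j. case (i, j) of (i, j) \<Rightarrow> B * (1 / 2) ^ i * (1 / 2) ^ j) has_sum (B * (1 / 2) ^ i * 2)) UNIV" for i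
      using geo[of "B * (1 / 2) ^ i"] B by simp
    show "(\<lambda>i. B * (1 / 2) ^ i * 2) summable_on UNIV"
      using geo[of "B * 2"] B by (auto simp: mult_ac has_sum_imp_summable)
  qed (use B in auto)
  then have "(\<lambda>p. norm ((\<lambda>(i, j). c i j * u ^ i * v ^ j) p)) summable_on UNIV"
    unfolding UNIV_Times_UNIV
    by (rule Infinite_Sum.abs_summable_on_comparison_test'[where f = "\<lambda>(i, j). c i j * u ^ i * v ^ j"])
      (use term_le in auto)
  then have summ: "(\<lambda>(i, j). c i j * u ^ i * v ^ j) summable_on Sigma UNIV (\<lambda>_. UNIV)"
    using abs_summable_summable unfolding UNIV_Times_UNIV by blast
  have inner_summ: "summable (\<lambda>j. norm (c i j * u ^ i * v ^ j))" for i
    by (rule summable_comparison_test'[OF summable_mult[OF summable_geometric[of "1 / 2 :: real"]]])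
      (use term_le in auto)
  have inner: "((\<lambda>j. c i j * u ^ i * v ^ j) has_sum ((\<Sum>j. c i j * v ^ j) * u ^ i)) UNIV" for i
  proof (cases "u ^ i = 0")
    case True
    show ?thesis unfolding True by simp
  next
    case False
    have "summable (\<lambda>j. c i j * u ^ i * v ^ j)" by (rule summable_norm_cancel[OF inner_summ])
    then have "summable (\<lambda>j. u ^ i * (c i j * v ^ j))" by (simp add: mult_ac)
    then have "summable (\<lambda>j. c i j * v ^ j)" using False by (simp add: summable_cmult_iff del: power_eq_0_iff)
    then have "(\<lambda>j. c i j * v ^ j * u ^ i) sums ((\<Sum>j. c i j * v ^ j) * u ^ i)"
      by (intro sums_mult2 summable_sums)
    then show ?thesis
      using inner_summ[of i] by (intro norm_summable_imp_has_sum) (auto simp: mult_ac)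
  qed
  obtain S where S: "((\<lambda>(i, j). c i j * u ^ i * v ^ j) has_sum S) (Sigma UNIV (\<lambda>_. UNIV))"
    using summ by (auto simp: summable_on_def)
  have "((\<lambda>i. (\<Sum>j. c i j * v ^ j) * u ^ i) has_sum S) UNIV"
    by (rule has_sum_SigmaD[OF S]) (use inner in auto)
  then have "S = (\<Sum>i. (\<Sum>j. c i j * v ^ j) * u ^ i)"
    using has_sum_imp_sums sums_unique by blast
  then show ?thesis using S by simp
qed

text \<open>
  The double Taylor coefficients of the functions \<open>F n\<close> satisfy the same Cauchy estimates, so along a
  subsequence all of them converge, and by dominated convergence (Tannery) the limiting double series
  has the sum \<open>f\<close> at every real point nearby. The real parts of its coefficients then expand \<open>f\<close>.
\<close>

lemma real_analytic_at_limit: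
  fixes F :: "nat \<Rightarrow> complex \<Rightarrow> complex \<Rightarrow> complex" and f :: "real \<times> real \<Rightarrow> real"
  assumes "0 < R"
    and hx: "\<And>n y. y \<in> ball (of_real b) R \<Longrightarrow> (\<lambda>x. F n x y) holomorphic_on ball (of_real a) R"
    and hy: "\<And>n x. x \<in> ball (of_real a) R \<Longrightarrow> F n x holomorphic_on ball (of_real b) R"
    and bound: "\<And>n x y. x \<in> ball (of_real a) R \<Longrightarrow> y \<in> ball (of_real b) R \<Longrightarrow> norm (F n x y) \<le> B"
    and lim: "\<And>x y. \<bar>x - a\<bar> < R \<Longrightarrow> \<bar>y - b\<bar> < R \<Longrightarrow>
      (\<lambda>n. F n (of_real x) (of_real y)) \<longlonglongrightarrow> of_real (f (x, y))"
  shows "real_analytic_at f (a, b)"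
proof -
  define s where "s = R / 2"
  have s: "0 < s" "s < R" using \<open>0 < R\<close> by (auto simp: s_def)
  define expansion where "expansion = (\<lambda>n (c :: nat \<Rightarrow> nat \<Rightarrow> complex).
      (\<forall>i j. norm (c i j) \<le> B / s ^ (i + j)) \<and>
      (\<forall>x\<in>ball (of_real a) s. \<forall>y\<in>ball (of_real b) s.
        (\<lambda>i. (\<Sum>j. c i j * (y - of_real b) ^ j) * (x - of_real a) ^ i) sums F n x y) \<and>
      (\<forall>i. \<forall>y\<in>ball (of_real b) s. norm (\<Sum>j. c i j * (y - of_real b) ^ j) \<le> B / s ^ i))"
  have "\<exists>c. expansion n c" for n
    unfolding expansion_def by (rule bounded_double_taylor[OF hx hy bound s])
  then have "\<forall>n. \<exists>c. expansion n c" ..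
  from choice[OF this] obtain c where "expansion n (c n)" for n by blast
  then have c: "norm (c n i j) \<le> B / s ^ (i + j)"
    and c_sums: "x \<in> ball (of_real a) s \<Longrightarrow> y \<in> ball (of_real b) s \<Longrightarrow>
        (\<lambda>i. (\<Sum>j. c n i j * (y - of_real b) ^ j) * (x - of_real a) ^ i) sums F n x y"
    and c_inner: "y \<in> ball (of_real b) s \<Longrightarrow>
        norm (\<Sum>j. c n i j * (y - of_real b) ^ j) \<le> B / s ^ i" for n i j x y
    unfolding expansion_def by (simp_all only:)
  \<comment> \<open>Rescaled, the coefficients are bounded by one constant, as the diagonal argument requires.\<close>
  define d where "d = (\<lambda>n (p :: nat \<times> nat). c n (fst p) (snd p) * of_real s ^ (fst p + snd p))"
  have d_bound: "norm (d n p) \<le> B" for n p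
    using c[of n "fst p" "snd p"] s by (simp add: d_def norm_mult norm_power field_simps)
  obtain k :: "nat \<Rightarrow> nat" where "strict_mono k"
    and k: "\<And>p. p \<in> UNIV \<Longrightarrow> \<exists>l. (\<lambda>n. d (k n) p) \<longlonglongrightarrow> l"
    by (rule function_convergent_subsequence[of UNIV d B, OF countableI_type d_bound that])
  have "\<exists>l. (\<lambda>n. c (k n) i j) \<longlonglongrightarrow> l" for i j
  proof -
    obtain l where "(\<lambda>n. c (k n) i j * of_real s ^ (i + j)) \<longlonglongrightarrow> l" using k[of "(i, j)"] by (auto simp: d_def)
    then have "(\<lambda>n. c (k n) i j * of_real s ^ (i + j) / of_real s ^ (i + j)) \<longlonglongrightarrow> l / of_real s ^ (i + j)"
      by (rule tendsto_divide[OF _ tendsto_const]) (use s in auto)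
    then show ?thesis using s by auto
  qed
  then obtain C where C: "\<And>i j. (\<lambda>n. c (k n) i j) \<longlonglongrightarrow> C i j" by metis
  have C_bound: "norm (C i j) \<le> B / s ^ (i + j)" for i j
    by (rule tendsto_upperbound[OF tendsto_norm[OF C]]) (use c in auto)
  have B: "0 \<le> B" using order_trans[OF norm_ge_zero c[of 0 0 0]] by simp
  have geo: "summable (\<lambda>k. r * (1 / 2) ^ k)" for r :: real
    by (intro summable_mult summable_geometric) auto
  have main: "((\<lambda>(i, j). Re (C i j) * (x - a) ^ i * (y - b) ^ j) has_sum f (x, y)) UNIV"
    if xy: "\<bar>x - a\<bar> < s / 2" "\<bar>y - b\<bar> < s / 2" for x y
  proof -
    define u v where "u = complex_of_real (x - a)" and "v = complex_of_real (y - b)"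
    have uv: "norm u \<le> s / 2" "norm v \<le> s / 2"
      using xy unfolding u_def v_def norm_of_real by auto
    have balls: "of_real x \<in> ball (complex_of_real a) s" "of_real y \<in> ball (complex_of_real b) s"
      using xy s by (auto simp: dist_of_real dist_real_def abs_minus_commute)
    have inner: "(\<lambda>n. \<Sum>j. c (k n) i j * v ^ j) \<longlonglongrightarrow> (\<Sum>j. C i j * v ^ j)" for i
    proof -
      have "norm (c n i j * v ^ j) \<le> B / s ^ i * (1 / 2) ^ j" for n j
      proof -
        have "norm (c n i j * v ^ j) \<le> B / s ^ (i + j) * (s / 2) ^ j"
          unfolding norm_mult norm_power using c uv B s by (intro mult_mono power_mono) auto
        also have "\<dots> = B / s ^ i * (1 / 2) ^ j" using s by (simp add: power_add power_divide)
        finally show ?thesis .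
      qed
      then show ?thesis
        by (intro tannerys_theorem[where M = "\<lambda>j. B / s ^ i * (1 / 2) ^ j", THEN conjunct2, THEN conjunct2]
            tendsto_mult tendsto_const C geo always_eventually) auto
    qed
    have "(\<lambda>n. \<Sum>i. (\<Sum>j. c (k n) i j * v ^ j) * u ^ i) \<longlonglongrightarrow> (\<Sum>i. (\<Sum>j. C i j * v ^ j) * u ^ i)"
    proof -
      have "norm ((\<Sum>j. c n i j * v ^ j) * u ^ i) \<le> B * (1 / 2) ^ i" for n i
      proof -
        have "norm ((\<Sum>j. c n i j * v ^ j) * u ^ i) \<le> B / s ^ i * (s / 2) ^ i"
          unfolding norm_mult norm_power using c_inner[OF balls(2), of n i] uv B s
          by (intro mult_mono power_mono) (auto simp: v_def)
        also have "\<dots> = B * (1 / 2) ^ i" using s by (simp add: power_divide)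
        finally show ?thesis .
      qed
      then show ?thesis
        by (intro tannerys_theorem[where M = "\<lambda>i. B * (1 / 2) ^ i", THEN conjunct2, THEN conjunct2]
            tendsto_mult tendsto_const inner geo always_eventually) auto
    qed
    moreover have "(\<Sum>i. (\<Sum>j. c (k n) i j * v ^ j) * u ^ i) = F (k n) (of_real x) (of_real y)" for n
      using c_sums[OF balls, of "k n"] by (simp add: sums_iff u_def v_def)
    moreover have "(\<lambda>n. F (k n) (of_real x) (of_real y)) \<longlonglongrightarrow> of_real (f (x, y))"
      using LIMSEQ_subseq_LIMSEQ[OF lim \<open>strict_mono k\<close>, of x y] xy s by (auto simp: o_def)
    ultimately have "(\<Sum>i. (\<Sum>j. C i j * v ^ j) * u ^ i) = of_real (f (x, y))"
      using LIMSEQ_unique by force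
    then have "((\<lambda>(i, j). C i j * u ^ i * v ^ j) has_sum of_real (f (x, y))) UNIV"
      using double_power_series_has_sum[OF C_bound s(1) uv] by simp
    from has_sum_Re[OF this] show ?thesis
      unfolding u_def v_def
      by (simp add: case_prod_unfold of_real_power[symmetric] del: of_real_power of_real_diff)
  qed
  show ?thesis
    unfolding real_analytic_at_def using s(1) main
    by (intro exI[of _ "\<lambda>p. Re (C (fst p) (snd p))"] exI[of _ "s / 2"]) auto
qed

section \<open>Complex parameters\<close>

definition complex_regime :: "real \<Rightarrow> complex \<Rightarrow> complex \<Rightarrow> bool" where
  "complex_regime b \<rho> \<beta> \<longleftrightarrow> 4 \<le> norm \<rho> \<and> norm (\<beta> - of_real b) \<le> b / 2"

text \<open>
  The condition \<open>Re (\<beta> * h k) \<ge> 0\<close> keeps the vacancy weights \<open>exp (- potential) / \<rho>\<close> as small as in the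
  real case. It is what the mean-field map reproduces for complex parameters.
\<close>

definition sector_profiles :: "complex \<Rightarrow> (nat \<Rightarrow> complex) set" where
  "sector_profiles \<beta> = {h. \<forall>k. 0 \<le> Re (\<beta> * h k) \<and> norm (h k) \<le> 2}"

lemma sector_potential:
  assumes "h \<in> sector_profiles \<beta>"
  shows "0 \<le> Re (potential \<beta> n h i)"
proof -
  have "potential \<beta> n h i = of_real (2 / real n) * (\<Sum>k<i. \<beta> * h k)"
    unfolding sum_distrib_left[symmetric] by (simp add: potential_def)
  moreover have "0 \<le> Re (\<Sum>k<i. \<beta> * h k)"
    using assms by (auto simp: sector_profiles_def intro!: sum_nonneg)
  ultimately show ?thesis
    by (simp only: Re_complex_of_real Im_complex_of_real times_complex.sel) simp
qed

lemma sector_boltzmann_small: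
  assumes "h \<in> sector_profiles \<beta>" "4 \<le> norm \<rho>"
  shows "norm (exp (- potential \<beta> n h i) / \<rho>) \<le> 1 / 4"
proof -
  have "norm (exp (- potential \<beta> n h i)) \<le> 1"
    using sector_potential[OF assms(1)] by simp
  then show ?thesis
    unfolding norm_divide using assms(2) by (intro frac_le) auto
qed

lemma one_plus_small:
  fixes w :: complex
  assumes "norm w \<le> 1 / 4"
  shows "3 / 4 \<le> norm (1 + w)" "1 + w \<notin> \<real>\<^sub>\<le>\<^sub>0" "1 + w \<noteq> 0"
proof -
  show "3 / 4 \<le> norm (1 + w)"
    using norm_triangle_ineq2[of 1 "- w"] assms by simp
  then show "1 + w \<noteq> 0" by auto
  have "- Re w \<le> 1 / 4" using abs_Re_le_cmod[of w] assms by linarith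
  then show "1 + w \<notin> \<real>\<^sub>\<le>\<^sub>0" by (auto simp: complex_nonpos_Reals_iff)
qed

text \<open>
  The occupation lies within \<open>1 / 3\<close> of \<open>1\<close> and \<open>\<beta>\<close> within \<open>b / 2\<close> of \<open>b\<close>, so their product lies
  within \<open>(b / 2) * (4 / 3) + b / 3 = b\<close> of \<open>b\<close>, hence in the right half-plane.
\<close>

lemma sector_occupation:
  assumes "h \<in> sector_profiles \<beta>" "complex_regime b \<rho> \<beta>"
  shows "0 \<le> Re (\<beta> * occupation \<rho> \<beta> n h i)" "norm (occupation \<rho> \<beta> n h i) \<le> 4 / 3"
proof -
  define w where "w = exp (- potential \<beta> n h i) / \<rho>"
  define p where "p = 1 / (1 + w)"
  have w: "norm w \<le> 1 / 4"
    unfolding w_def using assms by (intro sector_boltzmann_small) (auto simp: complex_regime_def)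
  note w1 = one_plus_small[OF w]
  have "norm p \<le> 1 / (3 / 4)"
    unfolding p_def norm_divide norm_one using w1(1) by (intro divide_left_mono) auto
  then have p: "norm p \<le> 4 / 3" by simp
  have "p - 1 = - w / (1 + w)" using w1(3) by (simp add: p_def field_simps)
  then have "norm (p - 1) = norm w / norm (1 + w)"
    by (simp add: norm_divide)
  also have "\<dots> \<le> (1 / 4) / (3 / 4)"
    using w w1(1) by (intro frac_le) auto
  finally have p1: "norm (p - 1) \<le> 1 / 3" by simp
  have \<beta>: "norm (\<beta> - of_real b) \<le> b / 2" using assms(2) by (simp add: complex_regime_def)
  then have "0 \<le> b" using norm_ge_zero[of "\<beta> - of_real b"] by linarith
  have "\<beta> * p - of_real b = (\<beta> - of_real b) * p + of_real b * (p - 1)"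
    by (simp add: algebra_simps)
  then have "norm (\<beta> * p - of_real b) \<le> norm (\<beta> - of_real b) * norm p + norm (of_real b :: complex) * norm (p - 1)"
    by (metis norm_mult norm_triangle_ineq)
  also have "\<dots> \<le> (b / 2) * (4 / 3) + b * (1 / 3)"
    using \<beta> p p1 \<open>0 \<le> b\<close> by (intro add_mono mult_mono) auto
  finally have "norm (\<beta> * p - of_real b) \<le> b" by simp
  then have "\<bar>Re (\<beta> * p) - b\<bar> \<le> b"
    using abs_Re_le_cmod[of "\<beta> * p - of_real b"] by simp
  then show "0 \<le> Re (\<beta> * occupation \<rho> \<beta> n h i)" by (simp add: occupation_def p_def w_def)
  show "norm (occupation \<rho> \<beta> n h i) \<le> 4 / 3" using p by (simp add: occupation_def p_def w_def)
qed

lemma mean_field_map_sector: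
  assumes "h \<in> sector_profiles \<beta>" "complex_regime b \<rho> \<beta>"
  shows "mean_field_map \<rho> \<beta> n h \<in> sector_profiles \<beta>"
proof -
  have "0 \<le> Re (\<beta> * mean_field_map \<rho> \<beta> n h k)" for k
  proof -
    have "\<beta> * mean_field_map \<rho> \<beta> n h k = (\<Sum>i=Suc k..<n. \<beta> * occupation \<rho> \<beta> n h i) / of_real (real n)"
      by (simp add: mean_field_map_def sum_distrib_left)
    moreover have "0 \<le> Re (\<Sum>i=Suc k..<n. \<beta> * occupation \<rho> \<beta> n h i)"
      using sector_occupation(1)[OF assms] by (simp add: sum_nonneg)
    ultimately show ?thesis by (simp only: Re_divide_of_real) simp
  qed
  moreover have "norm (mean_field_map \<rho> \<beta> n h k) \<le> 2" for k
  proof -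
    have "norm (\<Sum>i=Suc k..<n. occupation \<rho> \<beta> n h i) \<le> (\<Sum>i=Suc k..<n. 4 / 3)"
      by (rule sum_norm_le) (rule sector_occupation(2)[OF assms])
    also have "\<dots> \<le> 2 * real n"
    proof -
      have "real (n - Suc k) * (4 / 3) \<le> real n * 2" by (intro mult_mono) auto
      then show ?thesis by simp
    qed
    finally show ?thesis
      by (cases "n = 0") (auto simp: mean_field_map_def norm_divide divide_le_eq)
  qed
  ultimately show ?thesis by (simp add: sector_profiles_def)
qed

lemma mean_field_iterate_sector:
  assumes "complex_regime b \<rho> \<beta>"
  shows "(mean_field_map \<rho> \<beta> n ^^ j) (\<lambda>_. 0) \<in> sector_profiles \<beta>"
proof (induction j)
  case 0
  show ?case by (simp add: sector_profiles_def)
next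
  case (Suc j)
  then show ?case using mean_field_map_sector[OF Suc assms] by simp
qed

lemma mean_field_energy_bound:
  assumes "complex_regime b \<rho> \<beta>" "norm \<rho> \<le> K"
  shows "norm (mean_field_energy \<rho> \<beta> n) \<le> ln K + pi + 12 * b + 1"
proof -
  define h where "h = (mean_field_map \<rho> \<beta> n ^^ Suc n) (\<lambda>_. 0)"
  have h: "h \<in> sector_profiles \<beta>"
    unfolding h_def by (rule mean_field_iterate_sector[OF assms(1)])
  have \<rho>: "4 \<le> norm \<rho>" and \<beta>: "norm (\<beta> - of_real b) \<le> b / 2" using assms(1) by (auto simp: complex_regime_def)
  then have b: "0 \<le> b" using norm_ge_zero[of "\<beta> - of_real b"] by linarith
  have \<beta>n: "norm \<beta> \<le> 3 / 2 * b"
    using norm_triangle_ineq[of "\<beta> - of_real b" "of_real b"] \<beta> b by simp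
  have hn: "norm (h k) \<le> 2" for k using h by (simp add: sector_profiles_def)
  have 1: "norm (Ln \<rho>) \<le> ln K + pi"
  proof -
    have "\<rho> \<noteq> 0" using \<rho> by auto
    have "norm (Ln \<rho>) \<le> \<bar>Re (Ln \<rho>)\<bar> + \<bar>Im (Ln \<rho>)\<bar>" by (rule cmod_le)
    also have "\<bar>Re (Ln \<rho>)\<bar> \<le> ln K"
      using \<open>\<rho> \<noteq> 0\<close> \<rho> assms(2) by (simp add: Re_Ln)
    also have "\<bar>Im (Ln \<rho>)\<bar> \<le> pi"
      using \<open>\<rho> \<noteq> 0\<close> Im_Ln_le_pi[of \<rho>] mpi_less_Im_Ln[of \<rho>] by simp
    finally show ?thesis by simp
  qed
  have 2: "norm (potential \<beta> n h i + ln (1 + exp (- potential \<beta> n h i) / \<rho>)) \<le> 6 * b + 1" if "i < n" for i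
  proof -
    have "norm (\<Sum>k<i. h k) \<le> (\<Sum>k<i. 2)" by (rule sum_norm_le) (rule hn)
    then have "norm (\<Sum>k<i. h k) \<le> 2 * real n" using that by simp
    moreover have "2 * norm \<beta> / real n \<le> 3 * b / real n"
      using \<beta>n by (intro divide_right_mono) auto
    ultimately have "2 * norm \<beta> / real n * norm (\<Sum>k<i. h k) \<le> 3 * b / real n * (2 * real n)"
      using b by (intro mult_mono) auto
    moreover have "norm (potential \<beta> n h i) = 2 * norm \<beta> / real n * norm (\<Sum>k<i. h k)"
      by (simp add: potential_def norm_mult norm_divide)
    ultimately have "norm (potential \<beta> n h i) \<le> 3 * b / real n * (2 * real n)" by simp
    also have "\<dots> = 6 * b" using that by simp
    finally have "norm (potential \<beta> n h i) \<le> 6 * b" .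
    moreover have "norm (exp (- potential \<beta> n h i) / \<rho>) \<le> 1 / 4"
      by (rule sector_boltzmann_small[OF h \<rho>])
    then have "norm (Ln (1 + exp (- potential \<beta> n h i) / \<rho>)) \<le> 1"
      using norm_Ln_le[of "exp (- potential \<beta> n h i) / \<rho>"] by linarith
    ultimately show ?thesis by (intro norm_triangle_le) linarith
  qed
  have 3: "norm ((\<Sum>i<n. potential \<beta> n h i + ln (1 + exp (- potential \<beta> n h i) / \<rho>)) / of_nat n) \<le> 6 * b + 1"
  proof -
    have "norm (\<Sum>i<n. potential \<beta> n h i + ln (1 + exp (- potential \<beta> n h i) / \<rho>)) \<le> (\<Sum>i<n. 6 * b + 1)"
      by (rule sum_norm_le) (use 2 in auto)
    then show ?thesis using b by (cases "n = 0") (auto simp: norm_divide divide_le_eq mult.commute)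
  qed
  have 4: "norm (\<beta> * (\<Sum>k<n. (h k)\<^sup>2) / of_nat n) \<le> 6 * b"
  proof -
    have "norm (\<Sum>k<n. (h k)\<^sup>2) \<le> (\<Sum>k<n. 2\<^sup>2)"
      by (rule sum_norm_le) (use power_mono[OF hn norm_ge_zero, of _ 2] in \<open>simp add: norm_power\<close>)
    then have "norm \<beta> * norm (\<Sum>k<n. (h k)\<^sup>2) \<le> 3 / 2 * b * (4 * real n)"
      using \<beta>n b by (intro mult_mono) auto
    then show ?thesis using b by (cases "n = 0") (auto simp: norm_divide norm_mult divide_le_eq)
  qed
  show ?thesis
    unfolding mean_field_energy_def energy_def h_def[symmetric]
    by (rule order_trans[OF norm_triangle_ineq4], rule order_trans[OF add_right_mono[OF norm_triangle_ineq]])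
      (use 1 3 4 in linarith)
qed

text \<open>
  Stated along a holomorphic curve \<open>(f, g)\<close> of parameters, so that it yields holomorphy in \<open>\<rho>\<close> and in
  \<open>\<beta>\<close> alike.
\<close>

lemma mean_field_energy_holomorphic:
  assumes f: "f holomorphic_on S" and g: "g holomorphic_on S"
    and regime: "\<And>t. t \<in> S \<Longrightarrow> complex_regime b (f t) (g t)"
    and right: "\<And>t. t \<in> S \<Longrightarrow> 0 < Re (f t)"
  shows "(\<lambda>t. mean_field_energy (f t) (g t) n) holomorphic_on S"
proof -
  define H where "H = (\<lambda>j t. (mean_field_map (f t) (g t) n ^^ j) (\<lambda>_. 0))"
  have H_sector: "H j t \<in> sector_profiles (g t)" if "t \<in> S" for j t
    unfolding H_def by (rule mean_field_iterate_sector[OF regime[OF that]])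
  have small: "norm (exp (- potential (g t) n (H j t) i) / f t) \<le> 1 / 4" if "t \<in> S" for i j t
    using regime[OF that] by (intro sector_boltzmann_small[OF H_sector[OF that]]) (simp add: complex_regime_def)
  have f0: "f t \<noteq> 0" if "t \<in> S" for t using right[OF that] by auto
  have pot: "(\<lambda>t. potential (g t) n (H j t) i) holomorphic_on S"
    if "\<And>k. (\<lambda>t. H j t k) holomorphic_on S" for i j
    unfolding potential_def using that g by (intro holomorphic_intros) auto
  have H_hol: "(\<lambda>t. H j t k) holomorphic_on S" for j k
  proof (induction j arbitrary: k)
    case 0
    show ?case by (simp add: H_def)
  next
    case (Suc j)
    have "(\<lambda>t. (\<Sum>i=Suc k..<n. 1 / (1 + exp (- potential (g t) n (H j t) i) / f t)) / of_nat n) holomorphic_on S"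
    proof (cases "n = 0")
      case False
      then show ?thesis
        using f f0 one_plus_small(3)[OF small] by (intro holomorphic_intros pot Suc) auto
    qed simp
    moreover have "H (Suc j) t k = (\<Sum>i=Suc k..<n. 1 / (1 + exp (- potential (g t) n (H j t) i) / f t)) / of_nat n" for t
      by (simp add: H_def mean_field_map_def occupation_def)
    ultimately show ?case by simp
  qed
  have energy_H: "mean_field_energy (f t) (g t) n = energy (f t) (g t) n (H (Suc n) t)" for t
    by (simp only: mean_field_energy_def H_def)
  show ?thesis
  proof (cases "n = 0")
    case True
    then show ?thesis
      using f right unfolding mean_field_energy_def energy_def
      by (auto intro!: holomorphic_intros simp: complex_nonpos_Reals_iff) (use right in force)
  next
    case False
    have "f t \<notin> \<real>\<^sub>\<le>\<^sub>0" if "t \<in> S" for t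
      using right[OF that] by (auto simp: complex_nonpos_Reals_iff)
    then show ?thesis
      unfolding energy_H energy_def
      using False f g f0 one_plus_small(2)[OF small]
      by (intro holomorphic_intros pot H_hol) auto
  qed
qed

lemma mean_field_energy_of_real:
  fixes \<rho> \<beta> :: real
  assumes "\<rho> > 0"
  shows "mean_field_energy (of_real \<rho>) (of_real \<beta>) n = complex_of_real (mean_field_energy \<rho> \<beta> n)"
proof -
  have pot: "potential (complex_of_real \<beta>) n (\<lambda>k. of_real (h k)) i = of_real (potential \<beta> n h i)" for h i
    by (simp add: potential_def)
  have ex: "exp (- complex_of_real x) = of_real (exp (- x))" for x
    by (simp flip: exp_of_real)
  have map_eq: "mean_field_map (complex_of_real \<rho>) (of_real \<beta>) n (\<lambda>k. of_real (h k))
      = (\<lambda>k. of_real (mean_field_map \<rho> \<beta> n h k))" for h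
    by (simp add: fun_eq_iff mean_field_map_def occupation_def pot ex)
  have iter: "(mean_field_map (complex_of_real \<rho>) (of_real \<beta>) n ^^ j) (\<lambda>_. 0)
      = (\<lambda>k. of_real ((mean_field_map \<rho> \<beta> n ^^ j) (\<lambda>_. 0) k))" for j
    by (induction j) (simp_all add: map_eq)
  have ln_eq: "ln (1 + of_real (exp (- x)) / complex_of_real \<rho>) = of_real (ln (1 + exp (- x) / \<rho>))" for x :: real
  proof -
    have "1 + of_real (exp (- x)) / complex_of_real \<rho> = of_real (1 + exp (- x) / \<rho>)" by simp
    moreover have "0 < 1 + exp (- x) / \<rho>" using assms by (simp add: add_pos_pos)
    ultimately show ?thesis by (simp only: Ln_of_real)
  qed
  show ?thesis
    unfolding mean_field_energy_def iter energy_def pot ex ln_eq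
    using assms by (simp add: Ln_of_real)
qed

section \<open>Analyticity and absence of phase transitions\<close>

lemma lyapunov_exponent_analytic_at:
  assumes bm: "standard_brownian_motion M W" and adm: "admissible_scaling \<sigma> \<tau>" and "x0 > 0"
    and "\<rho> > 4" "\<beta> > 0"
  shows "real_analytic_at (lyapunov_exponent M W \<sigma> \<tau> x0) (\<rho>, \<beta>)"
proof -
  define R where "R = min (\<rho> - 4) (\<beta> / 2)"
  have R: "0 < R" "R \<le> \<rho> - 4" "R \<le> \<beta> / 2" using assms by (auto simp: R_def min_def)
  have Re_gt: "4 < Re x" if "x \<in> ball (complex_of_real \<rho>) R" for x
    using that R(2) abs_Re_le_cmod[of "complex_of_real \<rho> - x"] by (auto simp: dist_norm)
  have regime: "complex_regime \<beta> x y"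
    if "x \<in> ball (complex_of_real \<rho>) R" "y \<in> ball (complex_of_real \<beta>) R" for x y
    using Re_gt[OF that(1)] complex_Re_le_cmod[of x] that(2) R(3)
    by (auto simp: complex_regime_def dist_norm norm_minus_commute)
  show ?thesis
  proof (rule real_analytic_at_limit[where F = "\<lambda>n x y. mean_field_energy x y n", OF R(1)])
    fix n and y assume "y \<in> ball (complex_of_real \<beta>) R"
    then show "(\<lambda>x. mean_field_energy x y n) holomorphic_on ball (complex_of_real \<rho>) R"
      using regime Re_gt by (intro mean_field_energy_holomorphic[where b = \<beta>] holomorphic_intros) force+
  next
    fix n and x assume "x \<in> ball (complex_of_real \<rho>) R"
    then show "(\<lambda>y. mean_field_energy x y n) holomorphic_on ball (complex_of_real \<beta>) R"
      using regime Re_gt by (intro mean_field_energy_holomorphic[where b = \<beta>] holomorphic_intros) force+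
  next
    fix n x y assume xy: "x \<in> ball (complex_of_real \<rho>) R" "y \<in> ball (complex_of_real \<beta>) R"
    have "norm x \<le> norm (complex_of_real \<rho>) + norm (x - of_real \<rho>)" by (rule norm_triangle_sub)
    also have "\<dots> \<le> 2 * \<rho>" using xy(1) R(2) assms by (auto simp: dist_norm norm_minus_commute)
    finally show "norm (mean_field_energy x y n) \<le> ln (2 * \<rho>) + pi + 12 * \<beta> + 1"
      by (rule mean_field_energy_bound[OF regime[OF xy]])
  next
    fix x y assume "\<bar>x - \<rho>\<bar> < R" "\<bar>y - \<beta>\<bar> < R"
    then have xy: "x \<ge> 4" "y > 0" using R by auto
    show "(\<lambda>n. mean_field_energy (complex_of_real x) (of_real y) n)
        \<longlonglongrightarrow> of_real (lyapunov_exponent M W \<sigma> \<tau> x0 (x, y))"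
      using tendsto_of_real[OF lyapunov_exponent_mean_field[OF bm adm \<open>x0 > 0\<close> xy]] xy
      by (simp add: mean_field_energy_of_real)
  qed
qed

text \<open>
  If the boundary of a phase met the open connected region \<open>U\<close>, the union of the two would be a larger
  analyticity region, so the phase would contain \<open>U\<close> as part of its interior.
\<close>

lemma no_phase_transition_in_analyticity_region:
  assumes U: "analyticity_region f U" and "p \<in> U"
  shows "\<not> phase_transition j f p"
proof
  assume "phase_transition j f p"
  then obtain S where S: "phase f S" and p: "p \<in> frontier S"
    by (auto simp: phase_transition_def)
  then have region: "analyticity_region f S" by (simp add: phase_def)
  have "U \<inter> S \<noteq> {}"
    using p U \<open>p \<in> U\<close> by (auto simp: frontier_def analyticity_region_def closure_iff_nhds_not_empty)
  then have "connected (S \<union> U)"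
    using region U by (intro connected_Un) (auto simp: analyticity_region_def)
  then have "analyticity_region f (S \<union> U)"
    using region U by (auto simp: analyticity_region_def real_analytic_on_def)
  then have "S \<union> U = S" using S by (auto simp: phase_def)
  then have "p \<in> interior S"
    using \<open>p \<in> U\<close> region by (auto simp: analyticity_region_def interior_open)
  then show False using p by (simp add: frontier_def)
qed

theorem proposition17:
  "\<exists>\<rho>c::real. \<rho>c > 0 \<and>
     (\<forall>(M :: 'a measure) W \<sigma> \<tau> x0.
        standard_brownian_motion M W \<and> admissible_scaling \<sigma> \<tau> \<and> x0 > 0 \<longrightarrow>
          real_analytic_on (lyapunov_exponent M W \<sigma> \<tau> x0) ({\<rho>c<..} \<times> {0<..}) \<and>
          (\<forall>p \<in> {\<rho>c<..} \<times> {0<..}. \<forall>j.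
             \<not> phase_transition j (lyapunov_exponent M W \<sigma> \<tau> x0) p))"
proof (intro exI[of _ "4::real"] conjI allI impI)
  fix M :: "'a measure" and W \<sigma> \<tau> and x0 :: real
  assume "standard_brownian_motion M W \<and> admissible_scaling \<sigma> \<tau> \<and> x0 > 0"
  then show analytic: "real_analytic_on (lyapunov_exponent M W \<sigma> \<tau> x0) ({4<..} \<times> {0<..})"
    by (auto simp: real_analytic_on_def intro: lyapunov_exponent_analytic_at)
  have "analyticity_region (lyapunov_exponent M W \<sigma> \<tau> x0) ({4<..} \<times> {0<..})"
    unfolding analyticity_region_def parameter_space_def
    using analytic by (auto intro!: open_Times connected_Times convex_connected)
  then show "\<forall>p \<in> {4<..} \<times> {0<..}. \<forall>j. \<not> phase_transition j (lyapunov_exponent M W \<sigma> \<tau> x0) p"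
    using no_phase_transition_in_analyticity_region by blast
qed simp

end
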